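(* Let $\gamma(x,t)$ be a solution of the central affine curve flow $\gamma_t=\frac14q_x\gamma-\frac12q\gamma_x$ on $\mathbb{R}^2\setminus\{0\}$, $q$ its central affine curvature, and $E$ an extended frame for $q$ such that $E(0,0,0)=(\gamma,\gamma_x)$ at $(x,t)=(0,0)$. Write $$E(x,t,\lambda)=E_0(x,t)+E_1(x,t)\lambda+E_2(x,t)\lambda^2+\cdots.$$ Let $\xi\in\mathbb{R}$ be a constant, let $\mathcal{O}\subset\mathbb{R}^2$ be an open set on which $(1,\xi)\gamma$ does not vanish, and on $\mathcal{O}$ let $$\tilde\xi:=\frac{(1,\xi)\gamma_x}{(1,\xi)\gamma},$$ where $\gamma,\gamma_x$ are column vectors. Then $E_0(x,t)=E(x,t,0)=(\gamma,\gamma_x)$, and on $\mathcal{O}$ $$\tilde\gamma=e_{12}(-\tilde\xi\gamma+\gamma_x)+\begin{pmatrix}\xi&\xi^2\\1&\xi\end{pmatrix}E_1(x,t)\begin{pmatrix}-\tilde\xi\\1\end{pmatrix}$$ is a solution of the central affine curve flow with central affine curvature $\tilde q=-q+2\tilde\xi^2$. Moreover, $$\tilde E(x,t,\lambda)=\lambda^{-1}r_{\xi,0}(\lambda)\,E(x,t,\lambda)\,r_{-\tilde\xi(x,t),0}(\lambda)$$ is an extended frame for $\tilde q$, where $r_{\xi,0}(\lambda)=\begin{pmatrix}\xi&\xi^2+\lambda\\1&\xi\end{pmatrix}$.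
   Context: A solution of the central affine curve flow $\gamma_t=\frac14q_x\gamma-\frac12q\gamma_x$ is a smooth map $\gamma(x,t)$ into $\mathbb{R}^2\setminus\{0\}$ (column vectors) with $\det(\gamma,\gamma_x)=1$ satisfying this equation, where $q(\cdot,t)$ is the central affine curvature of $\gamma(\cdot,t)$, i.e. the unique smooth function with $\gamma_{xx}=q\gamma$. The given solution $\gamma$ is defined for $(x,t)\in\mathbb{R}^2$. It is known that $q$ then solves the KdV equation $q_t=\frac14(q_{xxx}-6qq_x)$. An extended frame of a solution $q$ of the KdV equation is a solution $E(x,t,\lambda)\in SL(2,\mathbb{C})$, holomorphic in $\lambda\in\mathbb{C}$ (for $\tilde E$, after removing the singularity at $\lambda=0$) and satisfying $\overline{E(x,t,\bar\lambda)}=E(x,t,\lambda)$, of $$E_x=E\begin{pmatrix}0&\lambda+q\\1&0\end{pmatrix},\qquad E_t=E\begin{pmatrix}\frac14q_x&\lambda^2+\frac12q\lambda+\frac14(q_{xx}-2q^2)\\\lambda-\frac q2&-\frac14q_x\end{pmatrix}.$$ $(\gamma,\gamma_x)$ denotes the $2\times2$ matrix with columns $\gamma,\gamma_x$, and $e_{12}=\begin{pmatrix}0&1\\0&0\end{pmatrix}$. *)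

theory Defs
  imports "HOL-Complex_Analysis.Complex_Analysis"
begin

text \<open>
  Functions of (x,t) are functions on \<open>real \<times> real\<close>; the first component is x, the second t.
\<close>

text \<open>C^n on an open set: all iterated directional derivatives up to order n exist as Frechet
  derivatives and are continuous. Only meant for open sets (derivatives are taken at full
  neighbourhoods).\<close>

primrec Ck_on ::
  "nat \<Rightarrow> 'a::euclidean_space set \<Rightarrow> ('a \<Rightarrow> 'b::real_normed_vector) \<Rightarrow> bool" where
  "Ck_on 0 S f \<longleftrightarrow> continuous_on S f"
| "Ck_on (Suc n) S f \<longleftrightarrow>
     (\<forall>p\<in>S. f differentiable (at p)) \<and>
     (\<forall>v. Ck_on n S (\<lambda>p. frechet_derivative f (at p) v))"

definition smooth_on :: "'a::euclidean_space set \<Rightarrow> ('a \<Rightarrow> 'b::real_normed_vector) \<Rightarrow> bool" where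
  "smooth_on S f \<longleftrightarrow> (\<forall>n. Ck_on n S f)"

text \<open>Partial derivatives. As usual for \<^const>\<open>vector_derivative\<close>, the value is meaningful
  only where the derivative exists; below they are applied to smooth functions only.\<close>

definition dx :: "(real \<times> real \<Rightarrow> 'b::real_normed_vector) \<Rightarrow> real \<times> real \<Rightarrow> 'b" where
  "dx f p = vector_derivative (\<lambda>s. f (s, snd p)) (at (fst p))"

definition dt :: "(real \<times> real \<Rightarrow> 'b::real_normed_vector) \<Rightarrow> real \<times> real \<Rightarrow> 'b" where
  "dt f p = vector_derivative (\<lambda>s. f (fst p, s)) (at (snd p))"

definition mat22 :: "'a::zero \<Rightarrow> 'a \<Rightarrow> 'a \<Rightarrow> 'a \<Rightarrow> 'a^2^2" where
  "mat22 a b c d = vector [vector [a, b], vector [c, d]]"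

definition cols :: "'a::zero^2 \<Rightarrow> 'a^2 \<Rightarrow> 'a^2^2" where
  "cols u v = mat22 (u$1) (v$1) (u$2) (v$2)"

definition cvec :: "real^2 \<Rightarrow> complex^2" where
  "cvec u = (\<chi> i. complex_of_real (u$i))"

definition cmat :: "real^2^2 \<Rightarrow> complex^2^2" where
  "cmat A = map_matrix complex_of_real A"

definition cnj_mat :: "complex^2^2 \<Rightarrow> complex^2^2" where
  "cnj_mat A = map_matrix cnj A"

definition smult_mat :: "complex \<Rightarrow> complex^2^2 \<Rightarrow> complex^2^2" where
  "smult_mat c A = map_matrix ((*) c) A"

text \<open>\<open>q\<close> is the central affine curvature of \<open>\<gamma>(\<cdot>,t)\<close> over the open set \<open>S\<close>; on \<open>S\<close> it is uniquely
  determined by \<open>\<gamma>\<close>, because \<open>\<gamma>\<close> does not vanish for the curves considered here.\<close>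

definition central_affine_curvature_on ::
  "(real \<times> real) set \<Rightarrow> (real \<times> real \<Rightarrow> real^2) \<Rightarrow> (real \<times> real \<Rightarrow> real) \<Rightarrow> bool" where
  "central_affine_curvature_on S \<gamma> q \<longleftrightarrow>
     smooth_on S q \<and> (\<forall>p\<in>S. dx (dx \<gamma>) p = q p *\<^sub>R \<gamma> p)"

text \<open>\<open>\<gamma>\<close> solves the central affine curve flow on the open set \<open>S\<close>, with curvature \<open>q\<close>.\<close>

definition caf_solution_on ::
  "(real \<times> real) set \<Rightarrow> (real \<times> real \<Rightarrow> real^2) \<Rightarrow> (real \<times> real \<Rightarrow> real) \<Rightarrow> bool" where
  "caf_solution_on S \<gamma> q \<longleftrightarrow>
     smooth_on S \<gamma> \<and>
     (\<forall>p\<in>S. \<gamma> p \<noteq> 0) \<and>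
     (\<forall>p\<in>S. det (cols (\<gamma> p) (dx \<gamma> p)) = 1) \<and>
     central_affine_curvature_on S \<gamma> q \<and>
     (\<forall>p\<in>S. dt \<gamma> p = (1/4 * dx q p) *\<^sub>R \<gamma> p - (1/2 * q p) *\<^sub>R dx \<gamma> p)"

definition kdv_solution_on :: "(real \<times> real) set \<Rightarrow> (real \<times> real \<Rightarrow> real) \<Rightarrow> bool" where
  "kdv_solution_on S q \<longleftrightarrow>
     smooth_on S q \<and>
     (\<forall>p\<in>S. dt q p = 1/4 * (dx (dx (dx q)) p - 6 * q p * dx q p))"

definition lax_U :: "(real \<times> real \<Rightarrow> real) \<Rightarrow> real \<times> real \<Rightarrow> complex \<Rightarrow> complex^2^2" where
  "lax_U q p z = mat22 0 (z + of_real (q p)) 1 0"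

definition lax_V :: "(real \<times> real \<Rightarrow> real) \<Rightarrow> real \<times> real \<Rightarrow> complex \<Rightarrow> complex^2^2" where
  "lax_V q p z =
     mat22 (of_real (1/4 * dx q p))
           (z^2 + of_real (1/2 * q p) * z + of_real (1/4 * (dx (dx q) p - 2 * (q p)^2)))
           (z - of_real (q p / 2))
           (- of_real (1/4 * dx q p))"

text \<open>The two linear equations include the existence of the partial derivatives of \<open>E\<close>; for fixed
  \<open>\<lambda>\<close>, smoothness in (x,t) then follows from the smoothness of \<open>q\<close>.\<close>

definition extended_frame_on ::
  "(real \<times> real) set \<Rightarrow> (real \<times> real \<Rightarrow> real) \<Rightarrow> (real \<times> real \<Rightarrow> complex \<Rightarrow> complex^2^2) \<Rightarrow> bool"
  where
  "extended_frame_on S q E \<longleftrightarrow>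
     kdv_solution_on S q \<and>
     (\<forall>p\<in>S. \<forall>z. det (E p z) = 1) \<and>
     (\<forall>p\<in>S. \<forall>i j. (\<lambda>z. E p z $ i $ j) holomorphic_on UNIV) \<and>
     (\<forall>p\<in>S. \<forall>z. cnj_mat (E p (cnj z)) = E p z) \<and>
     (\<forall>(x, t)\<in>S. \<forall>z.
        ((\<lambda>s. E (s, t) z) has_vector_derivative E (x, t) z ** lax_U q (x, t) z) (at x) \<and>
        ((\<lambda>s. E (x, s) z) has_vector_derivative E (x, t) z ** lax_V q (x, t) z) (at t))"

text \<open>Entrywise Taylor coefficients of \<open>E(x,t,\<lambda>)\<close> at \<open>\<lambda> = 0\<close>; the matrices \<open>E\<^sub>n(x,t)\<close>.\<close>

definition lambda_coeff ::
  "(real \<times> real \<Rightarrow> complex \<Rightarrow> complex^2^2) \<Rightarrow> nat \<Rightarrow> real \<times> real \<Rightarrow> complex^2^2" where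
  "lambda_coeff E n p = (\<chi> i j. (deriv ^^ n) (\<lambda>z. E p z $ i $ j) 0 / fact n)"

definition e12 :: "complex^2^2" where
  "e12 = mat22 0 1 0 0"

definition r0 :: "real \<Rightarrow> complex \<Rightarrow> complex^2^2" where
  "r0 \<xi> z = mat22 (of_real \<xi>) (of_real (\<xi>^2) + z) 1 (of_real \<xi>)"

definition xi_tilde :: "real \<Rightarrow> (real \<times> real \<Rightarrow> real^2) \<Rightarrow> real \<times> real \<Rightarrow> real" where
  "xi_tilde \<xi> \<gamma> p = (vector [1, \<xi>] \<bullet> dx \<gamma> p) / (vector [1, \<xi>] \<bullet> \<gamma> p)"

end

theory Submission
  imports Defs
begin

text \<open>
  Write \<open>G = (\<gamma>, \<gamma>\<^sub>x)\<close>. The curve flow says exactly that \<open>G\<close> satisfies the two linear equations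
  of the extended frame at \<open>\<lambda> = 0\<close> (\<open>frame_has_derivatives\<close>; the \<open>t\<close>-equation of the second column
  uses \<open>\<gamma>\<^sub>x\<^sub>t = \<gamma>\<^sub>t\<^sub>x\<close>). Two solutions of the same system differ by a constant left factor, so the
  initial condition forces \<open>E\<^sub>0 = G\<close>.

  The coefficient \<open>E\<^sub>1\<close> is a limit of difference quotients in \<open>\<lambda>\<close>, taken separately at each point
  \<open>(x,t)\<close>, so neither its regularity nor its derivatives are immediate. Both come from the relative frame
  \<open>F = E G\<^sup>-\<^sup>1\<close>. It is the identity at \<open>\<lambda> = 0\<close>, and its logarithmic derivative has a factor \<open>\<lambda>\<close>.
  An exponential growth bound then shows \<open>F \<rightarrow> 1\<close> uniformly on short intervals as \<open>\<lambda> \<rightarrow> 0\<close>, and hence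
  \<open>E\<^sub>1 G\<^sup>-\<^sup>1\<close> has the \<open>x\<close>-derivative \<open>G e\<^sub>1\<^sub>2 G\<^sup>-\<^sup>1\<close> and a similar \<open>t\<close>-derivative
  (\<open>first_order_variation\<close>). These no longer involve \<open>E\<^sub>1\<close> and are smooth in \<open>(x,t)\<close>, so \<open>E\<^sub>1\<close> is
  smooth, and its equations are the \<open>\<lambda>\<close>-derivatives of those of \<open>E\<close> (\<open>E1_derivatives\<close>).

  Now let \<open>w = (1,\<xi>)\<gamma>\<close>. Then \<open>\<xi>D = w\<^sub>x/w\<close> is a logarithmic derivative of a solution of \<open>w\<^sub>x\<^sub>x = q w\<close> and
  satisfies the Riccati equation \<open>\<xi>D\<^sub>x = q - \<xi>D\<^sup>2\<close>. This is what makes \<open>r\<^bsub>-\<xi>D\<^esub>\<close> a gauge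
  transformation from the Lax pair of \<open>q\<close> to that of \<open>qD = 2\<xi>D\<^sup>2 - q\<close> (\<open>r0_derivs\<close>), and it settles the
  equations of the new frame for \<open>\<lambda> \<noteq> 0\<close>. At \<open>\<lambda> = 0\<close> the matrix \<open>r\<^sub>\<xi> G r\<^bsub>-\<xi>D\<^esub>\<close> vanishes because
  \<open>w\<^sub>x = \<xi>D w\<close>; the singularity is therefore removable, and the value there is
  \<open>M r\<^bsub>-\<xi>D\<^esub> + r\<^sub>\<xi> G e\<^sub>1\<^sub>2\<close> with \<open>M = e\<^sub>1\<^sub>2 G + r\<^sub>\<xi> E\<^sub>1\<close>. Its first column is the new curve \<open>\<gamma>D\<close>
  and its second column is \<open>w (\<xi>,1)\<^sup>T - \<xi>D \<gamma>D = \<gamma>D\<^sub>x\<close>. That \<open>\<gamma>D\<close> solves the flow is a computation from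
  the equations of the columns of \<open>M\<close>, so the new frame at \<open>\<lambda> = 0\<close> satisfies the Lax equations for the
  same reason as \<open>G\<close> does.
\<close>

section \<open>Smooth functions on open sets\<close>

text \<open>Openness matters here and below: all derivatives are taken at full neighbourhoods.\<close>

lemma Ck_on_cong:
  assumes "open S" "\<And>p. p \<in> S \<Longrightarrow> f p = g p" "Ck_on n S f"
  shows "Ck_on n S g"
  using assms(2,3)
proof (induction n arbitrary: f g)
  case 0
  then show ?case by (simp cong: continuous_on_cong)
next
  case (Suc n)
  have eq: "(f has_derivative D) (at p) \<longleftrightarrow> (g has_derivative D) (at p)" if "p \<in> S" for p D
    using has_derivative_transform_within_open[OF _ \<open>open S\<close> that] Suc.prems(1) by metis
  have "frechet_derivative f (at p) = frechet_derivative g (at p)" if "p \<in> S" for p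
    unfolding frechet_derivative_def using eq[OF that] by simp
  then show ?case
    using Suc.prems(2) eq
    by (auto simp: differentiable_def intro: Suc.IH[of "\<lambda>p. frechet_derivative f (at p) _"])
qed

lemma Ck_on_SucI:
  assumes "open S" "\<And>p. p \<in> S \<Longrightarrow> (f has_derivative D p) (at p)"
    and "\<And>v. Ck_on n S (\<lambda>p. D p v)"
  shows "Ck_on (Suc n) S f"
proof -
  have "frechet_derivative f (at p) = D p" if "p \<in> S" for p
    using assms(2)[OF that] frechet_derivative_at by metis
  then have "Ck_on n S (\<lambda>p. frechet_derivative f (at p) v)" for v
    using Ck_on_cong[OF \<open>open S\<close> _ assms(3)] by simp
  then show ?thesis using assms(2) by (auto simp: differentiable_def)
qed

lemma Ck_on_SucD:
  assumes "Ck_on (Suc n) S f"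
  shows "p \<in> S \<Longrightarrow> (f has_derivative frechet_derivative f (at p)) (at p)"
    and "Ck_on n S (\<lambda>p. frechet_derivative f (at p) v)"
  using assms frechet_derivative_works by auto

lemma Ck_on_Suc_imp: "Ck_on (Suc n) S f \<Longrightarrow> Ck_on n S f"
proof (induction n arbitrary: f)
  case 0
  then show ?case
    by (auto intro!: continuous_at_imp_continuous_on differentiable_imp_continuous_within)
next
  case (Suc n)
  then show ?case unfolding Ck_on.simps(2)[of "Suc n"] Ck_on.simps(2)[of n] by blast
qed

lemma Ck_on_const: "open S \<Longrightarrow> Ck_on n S (\<lambda>p. c)"
proof (induction n arbitrary: c)
  case (Suc n)
  show ?case by (rule Ck_on_SucI[where D="\<lambda>p v. 0"]) (use Suc in auto)
qed auto

lemma Ck_on_linear: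
  assumes "open S" "bounded_linear h" "Ck_on n S f"
  shows "Ck_on n S (\<lambda>p. h (f p))"
  using assms(3)
proof (induction n arbitrary: f)
  case 0
  then show ?case
    using assms(2) by (simp add: linear_continuous_on_compose bounded_linear.continuous_on)
next
  case (Suc n)
  show ?case
    by (rule Ck_on_SucI[OF assms(1) bounded_linear.has_derivative[OF assms(2) Ck_on_SucD(1)[OF Suc.prems]]])
      (assumption, rule Suc.IH, rule Ck_on_SucD(2)[OF Suc.prems])
qed

lemma Ck_on_add:
  assumes "open S" "Ck_on n S f" "Ck_on n S g"
  shows "Ck_on n S (\<lambda>p. f p + g p)"
  using assms(2,3)
proof (induction n arbitrary: f g)
  case 0
  then show ?case by (auto intro: continuous_on_add)
next
  case (Suc n)
  show ?case
    by (rule Ck_on_SucI[OF assms(1) has_derivative_add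
          [OF Ck_on_SucD(1)[OF Suc.prems(1)] Ck_on_SucD(1)[OF Suc.prems(2)]]])
      (assumption, assumption, intro Suc.IH Ck_on_SucD(2)[OF Suc.prems(1)] Ck_on_SucD(2)[OF Suc.prems(2)])
qed

lemma Ck_on_bilinear:
  assumes "open S" "bounded_bilinear h" "Ck_on n S f" "Ck_on n S g"
  shows "Ck_on n S (\<lambda>p. h (f p) (g p))"
  using assms(3,4)
proof (induction n arbitrary: f g)
  case 0
  then show ?case by (simp add: bounded_bilinear.continuous_on[OF assms(2)])
next
  case (Suc n)
  show ?case
    by (rule Ck_on_SucI[OF assms(1) bounded_bilinear.FDERIV
          [OF assms(2) Ck_on_SucD(1)[OF Suc.prems(1)] Ck_on_SucD(1)[OF Suc.prems(2)]]])
      (assumption, assumption, intro Ck_on_add[OF assms(1)] Suc.IH Ck_on_SucD(2)[OF Suc.prems(1)]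
        Ck_on_SucD(2)[OF Suc.prems(2)] Suc.prems[THEN Ck_on_Suc_imp])
qed

lemma Ck_on_inverse:
  fixes f :: "'a::euclidean_space \<Rightarrow> real"
  assumes "open S" "Ck_on n S f" "\<And>p. p \<in> S \<Longrightarrow> f p \<noteq> 0"
  shows "Ck_on n S (\<lambda>p. inverse (f p))"
  using assms(2)
proof (induction n)
  case 0
  then show ?case using assms(3) by (auto intro: continuous_on_inverse)
next
  case (Suc n)
  note bl = Ck_on_bilinear[OF assms(1) bounded_bilinear_mult]
  have i: "Ck_on n S (\<lambda>p. inverse (f p))"
    using Suc Ck_on_Suc_imp by blast
  show ?case
    by (rule Ck_on_SucI[OF assms(1) Deriv.has_derivative_inverse
          [OF assms(3) Ck_on_SucD(1)[OF Suc.prems]]])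
      (assumption, assumption, intro bl i Ck_on_SucD(2)[OF Suc.prems]
        Ck_on_linear[OF assms(1) bounded_linear_minus[OF bounded_linear_ident]])
qed

context
  fixes S :: "'a::euclidean_space set"
  assumes S: "open S"
begin

lemma smooth_on_cong: "(\<And>p. p \<in> S \<Longrightarrow> f p = g p) \<Longrightarrow> smooth_on S f \<Longrightarrow> smooth_on S g"
  unfolding smooth_on_def using Ck_on_cong[OF S] by blast

lemma smooth_on_const: "smooth_on S (\<lambda>p. c)"
  unfolding smooth_on_def using Ck_on_const[OF S] by blast

lemma smooth_on_linear: "bounded_linear h \<Longrightarrow> smooth_on S f \<Longrightarrow> smooth_on S (\<lambda>p. h (f p))"
  unfolding smooth_on_def using Ck_on_linear[OF S] by blast

lemma smooth_on_add: "smooth_on S f \<Longrightarrow> smooth_on S g \<Longrightarrow> smooth_on S (\<lambda>p. f p + g p)"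
  unfolding smooth_on_def using Ck_on_add[OF S] by blast

lemma smooth_on_bilinear:
  "bounded_bilinear h \<Longrightarrow> smooth_on S f \<Longrightarrow> smooth_on S g \<Longrightarrow> smooth_on S (\<lambda>p. h (f p) (g p))"
  unfolding smooth_on_def using Ck_on_bilinear[OF S] by blast

lemma smooth_on_inverse:
  fixes f :: "'a \<Rightarrow> real"
  shows "smooth_on S f \<Longrightarrow> (\<And>p. p \<in> S \<Longrightarrow> f p \<noteq> 0) \<Longrightarrow> smooth_on S (\<lambda>p. inverse (f p))"
  unfolding smooth_on_def using Ck_on_inverse[OF S] by blast

lemma smooth_on_minus: "smooth_on S f \<Longrightarrow> smooth_on S (\<lambda>p. - f p)"
  by (rule smooth_on_linear[OF bounded_linear_minus[OF bounded_linear_ident]])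

lemma smooth_on_frechet: "smooth_on S f \<Longrightarrow> smooth_on S (\<lambda>p. frechet_derivative f (at p) v)"
  unfolding smooth_on_def using Ck_on_SucD(2) by blast

lemma smooth_on_has_derivative:
  "smooth_on S f \<Longrightarrow> p \<in> S \<Longrightarrow> (f has_derivative frechet_derivative f (at p)) (at p)"
  unfolding smooth_on_def using Ck_on_SucD(1) by blast

lemma smooth_on_imp_continuous_on: "smooth_on S f \<Longrightarrow> continuous_on S f"
  unfolding smooth_on_def by (metis Ck_on.simps(1))

end

lemmas smooth_on_mult = smooth_on_bilinear[OF _ bounded_bilinear_mult]

lemma smooth_on_subset: "smooth_on T f \<Longrightarrow> S \<subseteq> T \<Longrightarrow> smooth_on S f"
proof -
  assume st: "smooth_on T f" "S \<subseteq> T"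
  have "Ck_on n T g \<Longrightarrow> Ck_on n S g" for n and g :: "'a \<Rightarrow> 'b"
    by (induction n arbitrary: g) (use st(2) in \<open>auto intro: continuous_on_subset\<close>)
  with st show ?thesis by (simp add: smooth_on_def)
qed

section \<open>Partial derivatives\<close>

text \<open>Unlike an equation for \<open>dx f p\<close> or \<open>dt f p\<close>, these predicates include the existence of the
  derivative.\<close>

definition has_dx where
  "has_dx f d p \<longleftrightarrow> ((\<lambda>s. f (s, snd p)) has_vector_derivative d) (at (fst p :: real))"

definition has_dt where
  "has_dt f d p \<longleftrightarrow> ((\<lambda>s. f (fst p, s)) has_vector_derivative d) (at (snd p :: real))"

lemma has_dx_imp_dx: "has_dx f d p \<Longrightarrow> dx f p = d"
  unfolding has_dx_def dx_def by (rule vector_derivative_at)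

lemma has_dt_imp_dt: "has_dt f d p \<Longrightarrow> dt f p = d"
  unfolding has_dt_def dt_def by (rule vector_derivative_at)

lemma has_derivative_imp_has_dx: "(f has_derivative D) (at p) \<Longrightarrow> has_dx f (D (1, 0)) p"
  unfolding has_dx_def has_vector_derivative_def
proof -
  assume D: "(f has_derivative D) (at p)"
  have "((\<lambda>s. (s, snd p)) has_derivative (\<lambda>h. (h, 0))) (at (fst p))"
    by (auto intro!: derivative_eq_intros)
  from diff_chain_at[OF this, of f D] D
  have 1: "((\<lambda>s. f (s, snd p)) has_derivative (\<lambda>h. D (h, 0))) (at (fst p))"
    by (simp add: o_def)
  have 2: "D (h, 0) = h *\<^sub>R D (1, 0)" for h
    using linear_scale[OF has_derivative_linear[OF D], of h "(1,0)"] by simp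
  show "((\<lambda>s. f (s, snd p)) has_derivative (\<lambda>h. h *\<^sub>R D (1, 0))) (at (fst p))"
    by (rule has_derivative_eq_rhs[OF 1]) (rule ext, rule 2)
qed

lemma has_derivative_imp_has_dt: "(f has_derivative D) (at p) \<Longrightarrow> has_dt f (D (0, 1)) p"
  unfolding has_dt_def has_vector_derivative_def
proof -
  assume D: "(f has_derivative D) (at p)"
  have "((\<lambda>s. (fst p, s)) has_derivative (\<lambda>h. (0, h))) (at (snd p))"
    by (auto intro!: derivative_eq_intros)
  from diff_chain_at[OF this, of f D] D
  have 1: "((\<lambda>s. f (fst p, s)) has_derivative (\<lambda>h. D (0, h))) (at (snd p))"
    by (simp add: o_def)
  have 2: "D (0, h) = h *\<^sub>R D (0, 1)" for h
    using linear_scale[OF has_derivative_linear[OF D], of h "(0,1)"] by simp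
  show "((\<lambda>s. f (fst p, s)) has_derivative (\<lambda>h. h *\<^sub>R D (0, 1))) (at (snd p))"
    by (rule has_derivative_eq_rhs[OF 1]) (rule ext, rule 2)
qed

lemma dx_eq_frechet:
  "open S \<Longrightarrow> smooth_on S f \<Longrightarrow> p \<in> S \<Longrightarrow> dx f p = frechet_derivative f (at p) (1, 0)"
  by (rule has_dx_imp_dx[OF has_derivative_imp_has_dx[OF smooth_on_has_derivative]])

lemma smooth_on_has_dx: "open S \<Longrightarrow> smooth_on S f \<Longrightarrow> p \<in> S \<Longrightarrow> has_dx f (dx f p) p"
  using has_derivative_imp_has_dx[OF smooth_on_has_derivative] dx_eq_frechet by metis

lemma dt_eq_frechet:
  "open S \<Longrightarrow> smooth_on S f \<Longrightarrow> p \<in> S \<Longrightarrow> dt f p = frechet_derivative f (at p) (0, 1)"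
  by (rule has_dt_imp_dt[OF has_derivative_imp_has_dt[OF smooth_on_has_derivative]])

lemma smooth_on_has_dt: "open S \<Longrightarrow> smooth_on S f \<Longrightarrow> p \<in> S \<Longrightarrow> has_dt f (dt f p) p"
  using has_derivative_imp_has_dt[OF smooth_on_has_derivative] dt_eq_frechet by metis

lemma smooth_on_dx: "open S \<Longrightarrow> smooth_on S f \<Longrightarrow> smooth_on S (dx f)"
  by (rule smooth_on_cong[OF _ dx_eq_frechet[symmetric] smooth_on_frechet])

lemma smooth_on_dt: "open S \<Longrightarrow> smooth_on S f \<Longrightarrow> smooth_on S (dt f)"
  by (rule smooth_on_cong[OF _ dt_eq_frechet[symmetric] smooth_on_frechet])

lemma has_dx_cong:
  assumes "open S" "p \<in> S" "\<And>p. p \<in> S \<Longrightarrow> f p = g p" "has_dx f d p"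
  shows "has_dx g d p"
proof -
  have "open ((\<lambda>s. (s, snd p)) -` S)"
    by (rule open_vimage[OF assms(1)]) (intro continuous_intros)
  from has_vector_derivative_transform_within_open[OF _ this, of "\<lambda>s. f (s, snd p)" d "fst p" "\<lambda>s. g (s, snd p)"]
  show ?thesis using assms(2,3,4) by (simp add: has_dx_def)
qed

lemma has_dt_cong:
  assumes "open S" "p \<in> S" "\<And>p. p \<in> S \<Longrightarrow> f p = g p" "has_dt f d p"
  shows "has_dt g d p"
proof -
  have "open ((\<lambda>s. (fst p, s)) -` S)"
    by (rule open_vimage[OF assms(1)]) (intro continuous_intros)
  from has_vector_derivative_transform_within_open[OF _ this, of "\<lambda>s. f (fst p, s)" d "snd p" "\<lambda>s. g (fst p, s)"]
  show ?thesis using assms(2,3,4) by (simp add: has_dt_def)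
qed

text \<open>Only the existence of the partial derivatives of \<open>f\<close> is known, not even its continuity. A function
  with continuous partial derivatives is differentiable, and its directional derivatives are then
  combinations of the smooth functions \<open>A\<close> and \<open>B\<close>.\<close>

lemma smooth_of_partials:
  fixes f :: "real \<times> real \<Rightarrow> 'b::real_normed_vector"
  assumes x: "\<And>p. has_dx f (A p) p" and t: "\<And>p. has_dt f (B p) p"
    and A: "smooth_on UNIV A" and B: "smooth_on UNIV B"
  shows "smooth_on UNIV f"
proof -
  have D: "(f has_derivative (\<lambda>v. fst v *\<^sub>R A p + snd v *\<^sub>R B p)) (at p)" for p
  proof -
    obtain x t where p: "p = (x, t)" by fastforce
    have "((\<lambda>(x, t). f (x, t)) has_derivative (\<lambda>(h, k). h *\<^sub>R A p + blinfun_scaleR_left (B (x, t)) k))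
        (at (x, t) within UNIV \<times> UNIV)"
    proof (rule has_derivative_partialsI)
      show "((\<lambda>x. f (x, t)) has_derivative (\<lambda>h. h *\<^sub>R A p)) (at x within UNIV)"
        using x[of p] by (simp add: has_dx_def has_vector_derivative_def p)
      show "((\<lambda>t. f (x, t)) has_derivative blinfun_apply (blinfun_scaleR_left (B (x, t)))) (at t within UNIV)" for x t
        using t[of "(x,t)"] by (simp add: has_dt_def has_vector_derivative_def)
      have "continuous_on UNIV (\<lambda>p. blinfun_scaleR_left (B p))"
        by (intro bounded_linear.continuous_on[OF bounded_linear_blinfun_scaleR_left]
            smooth_on_imp_continuous_on[OF _ B]) auto
      then show "continuous (at (x, t) within UNIV \<times> UNIV) (\<lambda>(x, t). blinfun_scaleR_left (B (x, t)))"
        by (simp add: continuous_on_eq_continuous_at case_prod_unfold)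
    qed auto
    then show ?thesis by (simp add: p case_prod_unfold)
  qed
  have "Ck_on n UNIV f" for n
  proof -
    have "Ck_on (Suc n) UNIV f"
    proof (rule Ck_on_SucI[OF _ D])
      fix v :: "real \<times> real"
      have "smooth_on UNIV (\<lambda>p. fst v *\<^sub>R A p + snd v *\<^sub>R B p)"
        by (intro smooth_on_add smooth_on_bilinear[OF _ bounded_bilinear_scaleR] smooth_on_const A B) auto
      then show "Ck_on n UNIV (\<lambda>p. fst v *\<^sub>R A p + snd v *\<^sub>R B p)"
        by (simp add: smooth_on_def)
    qed auto
    then show ?thesis by (rule Ck_on_Suc_imp)
  qed
  then show ?thesis by (simp add: smooth_on_def)
qed

text \<open>The mean value theorem, applied first to the \<open>t\<close>-increment as a function of \<open>x\<close> and then to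
  \<open>fx\<close> as a function of \<open>t\<close>.\<close>

lemma second_difference_mvt:
  fixes f fx fxt :: "real \<times> real \<Rightarrow> real"
  assumes h: "h > 0"
    and box: "\<And>u v. x \<le> u \<Longrightarrow> u \<le> x + h \<Longrightarrow> t \<le> v \<Longrightarrow> v \<le> t + h \<Longrightarrow> (u, v) \<in> S"
    and fx: "\<And>p. p \<in> S \<Longrightarrow> has_dx f (fx p) p" and fxt: "\<And>p. p \<in> S \<Longrightarrow> has_dt fx (fxt p) p"
  shows "\<exists>u v. x \<le> u \<and> u \<le> x + h \<and> t \<le> v \<and> v \<le> t + h \<and>
    f (x + h, t + h) - f (x, t + h) - f (x + h, t) + f (x, t) = h * h * fxt (u, v)"
proof -
  have "\<exists>u. x < u \<and> u < x + h \<and>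
     (f (x + h, t + h) - f (x + h, t)) - (f (x, t + h) - f (x, t)) = (x + h - x) * (fx (u, t + h) - fx (u, t))"
  proof (rule MVT2)
    fix u assume "x \<le> u" "u \<le> x + h"
    then show "((\<lambda>u. f (u, t + h) - f (u, t)) has_real_derivative fx (u, t + h) - fx (u, t)) (at u)"
      using fx[of "(u, t + h)"] fx[of "(u, t)"] box h
      by (intro derivative_intros) (auto simp: has_dx_def has_real_derivative_iff_has_vector_derivative)
  qed (use h in auto)
  then obtain u where u: "x < u" "u < x + h" and
    1: "(f (x + h, t + h) - f (x + h, t)) - (f (x, t + h) - f (x, t)) = h * (fx (u, t + h) - fx (u, t))"
    by auto
  have "\<exists>v. t < v \<and> v < t + h \<and> fx (u, t + h) - fx (u, t) = (t + h - t) * fxt (u, v)"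
  proof (rule MVT2)
    fix v assume "t \<le> v" "v \<le> t + h"
    then show "((\<lambda>v. fx (u, v)) has_real_derivative fxt (u, v)) (at v)"
      using fxt[of "(u, v)"] box u
      by (auto simp: has_dt_def has_real_derivative_iff_has_vector_derivative)
  qed (use h in auto)
  then obtain v where "t < v" "v < t + h" "fx (u, t + h) - fx (u, t) = h * fxt (u, v)" by auto
  with u 1 show ?thesis by (intro exI[of _ u] exI[of _ v]) (auto simp: algebra_simps)
qed

text \<open>Schwarz's theorem: the second difference is symmetric in the two variables, so both mixed
  derivatives, at suitable points near \<open>p\<close>, equal the same number.\<close>

lemma mixed_partials_eq:
  fixes f :: "real \<times> real \<Rightarrow> real"
  assumes S: "open S" and p: "p \<in> S" and f: "smooth_on S f"
  shows "dt (dx f) p = dx (dt f) p"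
proof (rule ccontr)
  let ?A = "dt (dx f)" and ?B = "dx (dt f)"
  assume ne: "?A p \<noteq> ?B p"
  define e where "e = \<bar>?A p - ?B p\<bar> / 2"
  have e: "e > 0" using ne by (simp add: e_def)
  obtain x t where pxt: "p = (x, t)" by fastforce
  note sm = smooth_on_dx[OF S f] smooth_on_dt[OF S f]
  have cA: "continuous_on S ?A" and cB: "continuous_on S ?B"
    using sm smooth_on_dt[OF S] smooth_on_dx[OF S] smooth_on_imp_continuous_on[OF S] by blast+
  obtain d1 where d1: "d1 > 0" "ball p d1 \<subseteq> S" using S p openE by blast
  obtain d2 where d2: "d2 > 0" "\<And>y. y \<in> S \<Longrightarrow> dist y p < d2 \<Longrightarrow> dist (?A y) (?A p) < e"
    using cA p e unfolding continuous_on_iff by blast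
  obtain d3 where d3: "d3 > 0" "\<And>y. y \<in> S \<Longrightarrow> dist y p < d3 \<Longrightarrow> dist (?B y) (?B p) < e"
    using cB p e unfolding continuous_on_iff by blast
  define h where "h = min d1 (min d2 d3) / 3"
  have h: "h > 0" using d1 d2 d3 by (simp add: h_def)
  have near: "dist (u, v) p < 3 * h" if "x \<le> u" "u \<le> x + h" "t \<le> v" "v \<le> t + h" for u v
  proof -
    have "dist (u, v) p \<le> \<bar>u - x\<bar> + \<bar>v - t\<bar>"
      using sqrt_sum_squares_le_sum_abs[of "u - x" "v - t"] by (simp add: pxt dist_Pair_Pair dist_real_def)
    then show ?thesis using that h by auto
  qed
  have box: "(u, v) \<in> S" if "x \<le> u" "u \<le> x + h" "t \<le> v" "v \<le> t + h" for u v
    using near[OF that] d1(2) by (auto simp: h_def dist_commute subset_iff)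
  obtain u v where uv: "x \<le> u" "u \<le> x + h" "t \<le> v" "v \<le> t + h"
    and 1: "f (x + h, t + h) - f (x, t + h) - f (x + h, t) + f (x, t) = h * h * ?A (u, v)"
    using second_difference_mvt[OF h box smooth_on_has_dx[OF S f] smooth_on_has_dt[OF S sm(1)]] by blast
  \<comment> \<open>exchanging the variables gives the other order of differentiation\<close>
  let ?sw = "\<lambda>g :: real \<times> real \<Rightarrow> real. g \<circ> prod.swap"
  have "\<exists>v u. t \<le> v \<and> v \<le> t + h \<and> x \<le> u \<and> u \<le> x + h \<and>
    ?sw f (t + h, x + h) - ?sw f (t, x + h) - ?sw f (t + h, x) + ?sw f (t, x) = h * h * ?sw ?B (v, u)"
  proof (rule second_difference_mvt[OF h, where S="prod.swap ` S"])
    show "(v, u) \<in> prod.swap ` S" if "t \<le> v" "v \<le> t + h" "x \<le> u" "u \<le> x + h" for u v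
      using box[OF that(3,4,1,2)] by force
    show "has_dx (?sw f) (?sw (dt f) p) p" if "p \<in> prod.swap ` S" for p
      using that smooth_on_has_dt[OF S f] by (auto simp: has_dx_def has_dt_def)
    show "has_dt (?sw (dt f)) (?sw ?B p) p" if "p \<in> prod.swap ` S" for p
      using that smooth_on_has_dx[OF S sm(2)] by (auto simp: has_dx_def has_dt_def)
  qed
  then obtain u' v' where uv': "x \<le> u'" "u' \<le> x + h" "t \<le> v'" "v' \<le> t + h"
    and 2: "f (x + h, t + h) - f (x + h, t) - f (x, t + h) + f (x, t) = h * h * ?B (u', v')"
    by auto
  have "h * h * ?A (u, v) = h * h * ?B (u', v')" using 1 2 by linarith
  then have eq: "?A (u, v) = ?B (u', v')" using h by simp
  have "dist (?A (u, v)) (?A p) < e" "dist (?B (u', v')) (?B p) < e"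
    using d2(2)[OF box[OF uv]] d3(2)[OF box[OF uv']] near[OF uv] near[OF uv'] by (auto simp: h_def)
  then show False using eq unfolding e_def dist_real_def by (smt (verit) field_sum_of_halves)
qed

section \<open>Two by two matrices\<close>

lemma mat22_nth [simp]:
  "mat22 a b c d $ 1 $ 1 = a" "mat22 a b c d $ 1 $ 2 = b"
  "mat22 a b c d $ 2 $ 1 = c" "mat22 a b c d $ 2 $ 2 = d"
  by (simp_all add: mat22_def)

lemma mat22_eta: "A = mat22 (A$1$1) (A$1$2) (A$2$1) (A$2$2)"
  by (simp add: vec_eq_iff forall_2)

lemma mat22_mult:
  fixes a :: "'a::comm_semiring_1"
  shows "mat22 a b c d ** mat22 a' b' c' d' =
    mat22 (a * a' + b * c') (a * b' + b * d') (c * a' + d * c') (c * b' + d * d')"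
  by (simp add: vec_eq_iff forall_2 matrix_matrix_mult_def sum_2)

lemma mat22_add: "mat22 a b c d + mat22 a' b' c' d' = mat22 (a + a') (b + b') (c + c') (d + d' :: 'a::monoid_add)"
  by (simp add: vec_eq_iff forall_2)

lemma mat22_eq_iff: "mat22 a b c d = mat22 a' b' c' d' \<longleftrightarrow> a = a' \<and> b = b' \<and> c = c' \<and> d = d'"
  by (auto simp: vec_eq_iff forall_2)

lemma det_mat22: "det (mat22 a b c d) = a * d - b * (c :: 'a::comm_ring_1)"
  by (simp add: det_2)

lemma mat_2_eq_mat22: "mat c = mat22 c 0 0 c"
  by (simp add: vec_eq_iff forall_2 mat_def)

text \<open>The adjugate, which is the inverse on matrices of determinant 1 but depends linearly on its
  argument; inverse frames can therefore be differentiated by linearity.\<close>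

definition adj :: "'a::ab_group_add^2^2 \<Rightarrow> 'a^2^2" where
  "adj A = mat22 (A$2$2) (- A$1$2) (- A$2$1) (A$1$1)"

lemma adj_mult_left: "adj A ** A = mat (det (A :: 'a::comm_ring_1^2^2))"
  by (subst (2) mat22_eta) (simp add: adj_def mat22_mult det_2 mat_2_eq_mat22 mat22_eq_iff algebra_simps)

lemma adj_mult_right: "A ** adj A = mat (det (A :: 'a::comm_ring_1^2^2))"
  by (subst mat22_eta) (simp add: adj_def mat22_mult det_2 mat_2_eq_mat22 mat22_eq_iff algebra_simps)

lemma adj_mult: "adj (A ** B) = adj B ** adj (A :: 'a::comm_ring_1^2^2)"
  by (simp add: adj_def matrix_matrix_mult_def sum_2 vec_eq_iff forall_2 algebra_simps)

lemma adj_trace_free: "A$1$1 + A$2$2 = 0 \<Longrightarrow> adj A = - (A :: 'a::comm_ring_1^2^2)"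
  by (simp add: adj_def vec_eq_iff forall_2 eq_neg_iff_add_eq_0 add.commute)

lemma bounded_linear_adj: "bounded_linear (adj :: complex^2^2 \<Rightarrow> complex^2^2)"
  by (simp add: linear_conv_bounded_linear[symmetric] linear_iff adj_def vec_eq_iff forall_2)

lemma bounded_bilinear_matrix_mult: "bounded_bilinear ((**) :: complex^2^2 \<Rightarrow> complex^2^2 \<Rightarrow> complex^2^2)"
  by (simp add: bilinear_conv_bounded_bilinear[symmetric] bilinear_def linear_iff vec_eq_iff forall_2
      matrix_matrix_mult_def sum_2 algebra_simps)

lemma smult_mat_eq_mat_mult: "smult_mat c A = mat c ** A"
  by (simp add: smult_mat_def map_matrix_def mat_def matrix_matrix_mult_def vec_eq_iff forall_2 sum_2)

section \<open>First variation of a family of linear equations\<close>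

text \<open>A Gronwall estimate: the derivative bound makes \<open>\<bar>f\<bar>\<^sup>2 e\<^bsup>-2M(s-a)\<^esup>\<close> nonincreasing.\<close>

lemma norm_growth_bound:
  fixes f :: "real \<Rightarrow> 'a::real_inner"
  assumes "a \<le> b" and f: "\<And>s. a \<le> s \<Longrightarrow> s \<le> b \<Longrightarrow> (f has_vector_derivative f' s) (at s)"
    and bd: "\<And>s. a \<le> s \<Longrightarrow> s \<le> b \<Longrightarrow> norm (f' s) \<le> M * norm (f s)"
  shows "norm (f b) \<le> norm (f a) * exp (M * (b - a))"
proof -
  let ?\<phi> = "\<lambda>s. (f s \<bullet> f s) * exp (- 2 * M * (s - a))"
  have "?\<phi> b \<le> ?\<phi> a"
  proof (rule DERIV_nonpos_imp_nonincreasing[OF \<open>a \<le> b\<close>])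
    fix s assume s: "a \<le> s" "s \<le> b"
    have "((\<lambda>s. f s \<bullet> f s) has_real_derivative 2 * (f s \<bullet> f' s)) (at s)"
      using bounded_bilinear.has_vector_derivative[OF bounded_bilinear_inner f[OF s] f[OF s]]
      by (simp add: has_real_derivative_iff_has_vector_derivative inner_commute)
    then have D: "(?\<phi> has_real_derivative
        2 * (f s \<bullet> f' s - M * (f s \<bullet> f s)) * exp (- 2 * M * (s - a))) (at s)"
      by (auto intro!: derivative_eq_intros simp: algebra_simps)
    have "f s \<bullet> f' s \<le> norm (f s) * norm (f' s)" by (rule norm_cauchy_schwarz)
    also have "\<dots> \<le> norm (f s) * (M * norm (f s))" by (intro mult_left_mono bd s) auto
    also have "\<dots> = M * (f s \<bullet> f s)" by (simp add: power2_norm_eq_inner[symmetric] power2_eq_square)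
    finally have "2 * (f s \<bullet> f' s - M * (f s \<bullet> f s)) \<le> 0" by simp
    then have "2 * (f s \<bullet> f' s - M * (f s \<bullet> f s)) * exp (- 2 * M * (s - a)) \<le> 0"
      by (rule mult_nonpos_nonneg) simp
    with D show "\<exists>y. (?\<phi> has_real_derivative y) (at s) \<and> y \<le> 0" by blast
  qed
  moreover have "exp (- 2 * M * (b - a)) * (exp (M * (b - a)))\<^sup>2 = 1"
    by (simp add: exp_double[symmetric] mult_exp_exp)
  ultimately have "f b \<bullet> f b \<le> (f a \<bullet> f a) * (exp (M * (b - a)))\<^sup>2"
    using mult_right_mono[of "?\<phi> b" "?\<phi> a" "(exp (M * (b - a)))\<^sup>2"] by (simp add: mult.assoc)
  then have "(norm (f b))\<^sup>2 \<le> (norm (f a) * exp (M * (b - a)))\<^sup>2"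
    by (simp add: power2_norm_eq_inner power_mult_distrib)
  then show ?thesis by (rule power2_le_imp_le) simp
qed

lemma norm_growth_bound_two_sided:
  fixes f :: "real \<Rightarrow> 'a::real_inner"
  assumes f: "\<And>s. s \<in> cball a r \<Longrightarrow> (f has_vector_derivative f' s) (at s)"
    and bd: "\<And>s. s \<in> cball a r \<Longrightarrow> norm (f' s) \<le> M * norm (f s)" and s: "s \<in> cball a r"
  shows "norm (f s) \<le> norm (f a) * exp (M * \<bar>s - a\<bar>)"
proof (cases "a \<le> s")
  case True
  then show ?thesis
    using norm_growth_bound[OF True f bd] s by (auto simp: dist_real_def)
next
  case False
  have "norm (f (- (- s))) \<le> norm (f (- (- a))) * exp (M * (- s - - a))"
  proof (rule norm_growth_bound)
    fix u assume u: "- a \<le> u" "u \<le> - s"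
    with s have u': "- u \<in> cball a r" by (auto simp: dist_real_def)
    show "((\<lambda>u. f (- u)) has_vector_derivative - f' (- u)) (at u)"
      using vector_diff_chain_at[OF has_vector_derivative_minus[OF has_vector_derivative_id] f, of u] u'
      by (simp add: o_def)
    show "norm (- f' (- u)) \<le> M * norm (f (- u))" using bd[OF u'] by simp
  qed (use False in auto)
  with False show ?thesis by simp
qed

text \<open>Let \<open>f n\<close> solve \<open>f' = \<epsilon> f (K + \<epsilon> L)\<close> and tend to the identity at each point with first order
  coefficient \<open>l\<close>. The rescaled difference \<open>(f n - 1)/\<epsilon>\<close> has derivative \<open>f n (K + \<epsilon> L)\<close>, which tends to
  \<open>K\<close> uniformly near \<open>a\<close>: the growth bound controls \<open>f n\<close>, so \<open>f n\<close> varies only by \<open>O(\<epsilon>)\<close> on the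
  interval. Uniform convergence of the derivatives allows exchanging the limit with the derivative.\<close>

lemma first_order_variation:
  fixes f :: "nat \<Rightarrow> real \<Rightarrow> complex^2^2" and \<epsilon> :: "nat \<Rightarrow> real"
  assumes \<epsilon>: "\<And>n. 0 < \<epsilon> n" "\<And>n. \<epsilon> n \<le> 1" "\<epsilon> \<longlonglongrightarrow> 0"
    and f: "\<And>n s. (f n has_vector_derivative \<epsilon> n *\<^sub>R (f n s ** (K s + \<epsilon> n *\<^sub>R L s))) (at s)"
    and K: "continuous_on UNIV K" and L: "continuous_on UNIV L"
    and l: "\<And>s. (\<lambda>n. (f n s - mat 1) /\<^sub>R \<epsilon> n) \<longlonglongrightarrow> l s"
  shows "(l has_vector_derivative K a) (at a)"
proof -
  let ?S = "cball a 1"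
  obtain c where c: "c > 0" "\<And>(A :: complex^2^2) (B :: complex^2^2). norm (A ** B) \<le> norm A * norm B * c"
    using bounded_bilinear.pos_bounded[OF bounded_bilinear_matrix_mult] by blast
  have "bounded (K ` ?S)" "bounded (L ` ?S)"
    using K L by (auto intro!: compact_imp_bounded compact_continuous_image intro: continuous_on_subset)
  then obtain k1 k2 where k: "\<And>s. s \<in> ?S \<Longrightarrow> norm (K s) \<le> k1" "\<And>s. s \<in> ?S \<Longrightarrow> norm (L s) \<le> k2"
    unfolding bounded_iff by blast
  have k0: "0 \<le> k1" "0 \<le> k2"
    using order_trans[OF norm_ge_zero k(1)[of a]] order_trans[OF norm_ge_zero k(2)[of a]] by simp_all
  \<comment> \<open>right multiplication by \<open>K + \<epsilon> L\<close> has operator norm at most \<open>m\<close> on the interval\<close>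
  define m where "m = c * (k1 + k2)"
  have m0: "m \<ge> 0" using c k0 by (simp add: m_def)
  have KL: "norm (A ** (K s + \<epsilon> n *\<^sub>R L s)) \<le> m * norm A" if "s \<in> ?S" for A :: "complex^2^2" and s n
  proof -
    have "norm (K s + \<epsilon> n *\<^sub>R L s) \<le> norm (K s) + \<epsilon> n * norm (L s)"
      using norm_triangle_ineq[of "K s" "\<epsilon> n *\<^sub>R L s"] \<epsilon>(1)[of n] by simp
    also have "\<dots> \<le> k1 + 1 * k2"
      using k[OF that] \<epsilon>(1,2)[of n] k0 by (intro add_mono mult_mono) auto
    finally have le: "norm (K s + \<epsilon> n *\<^sub>R L s) \<le> k1 + k2" by simp
    have "norm (A ** (K s + \<epsilon> n *\<^sub>R L s)) \<le> norm A * norm (K s + \<epsilon> n *\<^sub>R L s) * c" by (rule c(2))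
    also have "\<dots> \<le> norm A * (k1 + k2) * c"
      using c(1) le by (intro mult_right_mono mult_left_mono) auto
    finally show ?thesis by (simp add: m_def mult_ac)
  qed
  have fa: "(\<lambda>n. f n a) \<longlonglongrightarrow> mat 1"
  proof -
    have "(\<lambda>n. \<epsilon> n *\<^sub>R ((f n a - mat 1) /\<^sub>R \<epsilon> n) + mat 1) \<longlonglongrightarrow> 0 *\<^sub>R l a + mat 1"
      by (intro tendsto_intros \<epsilon> l)
    moreover have "\<epsilon> n *\<^sub>R ((f n a - mat 1) /\<^sub>R \<epsilon> n) + mat 1 = f n a" for n
      using \<epsilon>(1)[of n] by simp
    ultimately show ?thesis by simp
  qed
  then obtain b0 where b0: "\<And>n. norm (f n a) \<le> b0"
    using convergent_imp_Bseq[of "\<lambda>n. f n a"] by (auto simp: convergent_def Bseq_def)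
  define b where "b = b0 * exp m"
  have fb: "norm (f n s) \<le> b" if s: "s \<in> ?S" for n s
  proof -
    have "norm (f n s) \<le> norm (f n a) * exp (m * \<bar>s - a\<bar>)"
    proof (rule norm_growth_bound_two_sided[OF f _ s])
      fix s assume "s \<in> ?S"
      from mult_mono[OF \<epsilon>(2)[of n] KL[OF this, of "f n s" n]]
      show "norm (\<epsilon> n *\<^sub>R (f n s ** (K s + \<epsilon> n *\<^sub>R L s))) \<le> m * norm (f n s)"
        using \<epsilon>(1)[of n] by simp
    qed
    also have "\<dots> \<le> b0 * exp (m * 1)"
    proof (rule mult_mono)
      have "\<bar>s - a\<bar> \<le> 1" using s by (simp add: dist_real_def abs_minus_commute)
      then show "exp (m * \<bar>s - a\<bar>) \<le> exp (m * 1)" using m0 by (simp add: mult_left_le)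
    qed (use b0 order_trans[OF norm_ge_zero b0] in auto)
    finally show ?thesis by (simp add: b_def)
  qed
  have b_nonneg: "b \<ge> 0" using order_trans[OF norm_ge_zero fb[of a 0]] by simp
  have drift: "norm (f n s - f n a) \<le> \<epsilon> n * (m * b)" if s: "s \<in> ?S" for n s
  proof -
    have "norm (f n s - f n a) \<le> \<epsilon> n * (m * b) * norm (s - a)"
    proof (rule differentiable_bound[where S="?S" and f'="\<lambda>s h. h *\<^sub>R \<epsilon> n *\<^sub>R (f n s ** (K s + \<epsilon> n *\<^sub>R L s))"])
      fix s assume s: "s \<in> ?S"
      show "(f n has_derivative (\<lambda>h. h *\<^sub>R \<epsilon> n *\<^sub>R (f n s ** (K s + \<epsilon> n *\<^sub>R L s)))) (at s within ?S)"
        using f[of n s] by (auto simp: has_vector_derivative_def intro: has_derivative_at_withinI)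
      have le: "norm (f n s ** (K s + \<epsilon> n *\<^sub>R L s)) \<le> m * b"
        using KL[OF s, of "f n s" n] mult_left_mono[OF fb[OF s, of n] m0] by linarith
      show "onorm (\<lambda>h. h *\<^sub>R \<epsilon> n *\<^sub>R (f n s ** (K s + \<epsilon> n *\<^sub>R L s))) \<le> \<epsilon> n * (m * b)"
      proof (intro onorm_le)
        fix h :: real
        show "norm (h *\<^sub>R \<epsilon> n *\<^sub>R (f n s ** (K s + \<epsilon> n *\<^sub>R L s))) \<le> \<epsilon> n * (m * b) * norm h"
          using mult_left_mono[OF le, of "\<bar>h\<bar> * \<epsilon> n"] \<epsilon>(1)[of n] by (simp add: abs_mult mult_ac)
      qed
    qed (use s in auto)
    also have "\<dots> \<le> \<epsilon> n * (m * b) * 1"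
      using s m0 b_nonneg \<epsilon>(1)[of n] by (intro mult_left_mono) (auto simp: dist_real_def abs_minus_commute)
    finally show ?thesis by simp
  qed
  define \<eta> where "\<eta> n = c * k1 * (\<epsilon> n * (m * b) + norm (f n a - mat 1)) + \<epsilon> n * (c * b * k2)" for n
  have \<eta>: "\<eta> \<longlonglongrightarrow> 0"
  proof -
    have "\<eta> \<longlonglongrightarrow> c * k1 * (0 * (m * b) + norm (mat 1 - mat 1 :: complex^2^2)) + 0 * (c * b * k2)"
      unfolding \<eta>_def by (intro tendsto_intros \<epsilon> fa)
    then show ?thesis by simp
  qed
  have unif: "norm (f n s ** (K s + \<epsilon> n *\<^sub>R L s) - K s) \<le> \<eta> n" if s: "s \<in> ?S" for n s
  proof -
    interpret bounded_bilinear "(**) :: complex^2^2 \<Rightarrow> complex^2^2 \<Rightarrow> complex^2^2"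
      by (rule bounded_bilinear_matrix_mult)
    have "f n s ** (K s + \<epsilon> n *\<^sub>R L s) - K s = (f n s - mat 1) ** K s + \<epsilon> n *\<^sub>R (f n s ** L s)"
      by (simp add: add_right diff_left scaleR_right)
    also have "norm \<dots> \<le> norm ((f n s - mat 1) ** K s) + \<epsilon> n * norm (f n s ** L s)"
      using norm_triangle_ineq[of "(f n s - mat 1) ** K s" "\<epsilon> n *\<^sub>R (f n s ** L s)"] \<epsilon>(1)[of n] by simp
    also have "norm ((f n s - mat 1) ** K s) \<le> norm (f n s - mat 1) * norm (K s) * c" by (rule c(2))
    also have "\<dots> \<le> (\<epsilon> n * (m * b) + norm (f n a - mat 1)) * k1 * c"
    proof -
      have "norm (f n s - mat 1) \<le> norm (f n s - f n a) + norm (f n a - mat 1)"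
        using norm_triangle_ineq[of "f n s - f n a" "f n a - mat 1"] by simp
      then show ?thesis
        using drift[OF s, of n] k(1)[OF s] c(1) k0 order_trans[OF norm_ge_zero drift[OF s, of n]]
        by (intro mult_right_mono mult_mono) auto
    qed
    also have "norm (f n s ** L s) \<le> norm (f n s) * norm (L s) * c" by (rule c(2))
    also have "\<dots> \<le> b * k2 * c"
      using fb[OF s, of n] k(2)[OF s] c(1) k0 b_nonneg by (intro mult_right_mono mult_mono) auto
    finally show ?thesis using \<epsilon>(1)[of n] by (simp add: \<eta>_def mult_ac)
  qed
  have "\<exists>g. \<forall>s\<in>?S. (\<lambda>n. (f n s - mat 1) /\<^sub>R \<epsilon> n) \<longlonglongrightarrow> g s \<and>
      (g has_derivative (\<lambda>h. h *\<^sub>R K s)) (at s within ?S)"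
  proof (rule has_derivative_sequence[where ?x0.0=a and l="l a"
        and f'="\<lambda>n s h. h *\<^sub>R (f n s ** (K s + \<epsilon> n *\<^sub>R L s))"])
    show "((\<lambda>s. (f n s - mat 1) /\<^sub>R \<epsilon> n) has_derivative (\<lambda>h. h *\<^sub>R (f n s ** (K s + \<epsilon> n *\<^sub>R L s))))
        (at s within ?S)" for n s
    proof -
      have "((\<lambda>s. (f n s - mat 1) /\<^sub>R \<epsilon> n) has_derivative
          (\<lambda>h. (h *\<^sub>R \<epsilon> n *\<^sub>R (f n s ** (K s + \<epsilon> n *\<^sub>R L s)) - 0) /\<^sub>R \<epsilon> n)) (at s)"
        by (intro derivative_intros f[unfolded has_vector_derivative_def])
      then show ?thesis
        using \<epsilon>(1)[of n] by (auto intro: has_derivative_at_withinI simp: field_simps)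
    qed
    show "\<forall>\<^sub>F n in sequentially. \<forall>s\<in>?S. \<forall>h.
        norm (h *\<^sub>R (f n s ** (K s + \<epsilon> n *\<^sub>R L s)) - h *\<^sub>R K s) \<le> e * norm h" if "e > 0" for e
      using order_tendstoD(2)[OF \<eta> that]
    proof eventually_elim
      case (elim n)
      show ?case
      proof (intro ballI allI)
        fix s h assume s: "s \<in> ?S"
        have "norm (h *\<^sub>R (f n s ** (K s + \<epsilon> n *\<^sub>R L s)) - h *\<^sub>R K s) = \<bar>h\<bar> * norm (f n s ** (K s + \<epsilon> n *\<^sub>R L s) - K s)"
          by (simp add: scaleR_diff_right[symmetric])
        also have "\<dots> \<le> \<bar>h\<bar> * e" using unif[OF s, of n] elim by (intro mult_left_mono) auto
        finally show "norm (h *\<^sub>R (f n s ** (K s + \<epsilon> n *\<^sub>R L s)) - h *\<^sub>R K s) \<le> e * norm h"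
          by (simp add: mult.commute)
      qed
    qed
  qed (use l in auto)
  moreover have a: "a \<in> ?S" by simp
  ultimately obtain g where g: "\<And>s. s \<in> ?S \<Longrightarrow> (\<lambda>n. (f n s - mat 1) /\<^sub>R \<epsilon> n) \<longlonglongrightarrow> g s"
    "(g has_derivative (\<lambda>h. h *\<^sub>R K a)) (at a within ?S)"
    by blast
  have "at a within ?S = at a" by (rule at_within_interior) simp
  with g(2) have "(g has_vector_derivative K a) (at a)"
    by (simp add: has_vector_derivative_def)
  then show ?thesis
  proof (rule has_vector_derivative_transform_within_open[where S="ball a 1"])
    fix s assume "s \<in> ball a 1"
    then have "s \<in> ?S" by simp
    then show "g s = l s" by (rule LIMSEQ_unique[OF g(1) l])
  qed auto
qed

section \<open>Rules for partial derivatives\<close>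

lemma has_dx_eq_rhs: "has_dx f d p \<Longrightarrow> d = d' \<Longrightarrow> has_dx f d' p"
  and has_dt_eq_rhs: "has_dt f d p \<Longrightarrow> d = d' \<Longrightarrow> has_dt f d' p"
  by simp_all

lemma has_dx_const: "has_dx (\<lambda>p. c) 0 p" and has_dt_const: "has_dt (\<lambda>p. c) 0 p"
  by (simp_all add: has_dx_def has_dt_def)

lemma has_dx_linear: "bounded_linear h \<Longrightarrow> has_dx f d p \<Longrightarrow> has_dx (\<lambda>p. h (f p)) (h d) p"
  and has_dt_linear: "bounded_linear h \<Longrightarrow> has_dt f d p \<Longrightarrow> has_dt (\<lambda>p. h (f p)) (h d) p"
  unfolding has_dx_def has_dt_def by (rule bounded_linear.has_vector_derivative; assumption)+

lemma has_dx_minus: "has_dx f d p \<Longrightarrow> has_dx (\<lambda>p. - f p) (- d) p"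
  and has_dt_minus: "has_dt f d p \<Longrightarrow> has_dt (\<lambda>p. - f p) (- d) p"
  by (simp_all add: has_dx_def has_dt_def has_vector_derivative_minus)

lemma has_dx_add: "has_dx f d p \<Longrightarrow> has_dx g e p \<Longrightarrow> has_dx (\<lambda>p. f p + g p) (d + e) p"
  and has_dt_add: "has_dt f d p \<Longrightarrow> has_dt g e p \<Longrightarrow> has_dt (\<lambda>p. f p + g p) (d + e) p"
  by (simp_all add: has_dx_def has_dt_def has_vector_derivative_add)

lemma has_dx_diff: "has_dx f d p \<Longrightarrow> has_dx g e p \<Longrightarrow> has_dx (\<lambda>p. f p - g p) (d - e) p"
  and has_dt_diff: "has_dt f d p \<Longrightarrow> has_dt g e p \<Longrightarrow> has_dt (\<lambda>p. f p - g p) (d - e) p"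
  by (simp_all add: has_dx_def has_dt_def has_vector_derivative_diff)

lemma has_dx_bilinear:
  "bounded_bilinear h \<Longrightarrow> has_dx f d p \<Longrightarrow> has_dx g e p \<Longrightarrow>
    has_dx (\<lambda>p. h (f p) (g p)) (h (f p) e + h d (g p)) p"
  and has_dt_bilinear:
  "bounded_bilinear h \<Longrightarrow> has_dt f d p \<Longrightarrow> has_dt g e p \<Longrightarrow>
    has_dt (\<lambda>p. h (f p) (g p)) (h (f p) e + h d (g p)) p"
  unfolding has_dx_def has_dt_def
  using bounded_bilinear.has_vector_derivative[of h "\<lambda>s. f (s, snd p)" d "fst p" UNIV "\<lambda>s. g (s, snd p)" e]
    bounded_bilinear.has_vector_derivative[of h "\<lambda>s. f (fst p, s)" d "snd p" UNIV "\<lambda>s. g (fst p, s)" e]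
  by auto

lemmas has_dx_mult = has_dx_bilinear[OF bounded_bilinear_mult]
lemmas has_dt_mult = has_dt_bilinear[OF bounded_bilinear_mult]
lemmas has_dx_scaleR = has_dx_bilinear[OF bounded_bilinear_scaleR]
lemmas has_dt_scaleR = has_dt_bilinear[OF bounded_bilinear_scaleR]
lemmas has_dx_matrix_mult = has_dx_bilinear[OF bounded_bilinear_matrix_mult]
lemmas has_dt_matrix_mult = has_dt_bilinear[OF bounded_bilinear_matrix_mult]

lemmas has_dx_intros = has_dx_const has_dx_minus has_dx_add has_dx_diff has_dx_mult has_dx_scaleR
lemmas has_dt_intros = has_dt_const has_dt_minus has_dt_add has_dt_diff has_dt_mult has_dt_scaleR

lemma has_dx_divide:
  fixes f g :: "real \<times> real \<Rightarrow> real"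
  shows "has_dx f d p \<Longrightarrow> has_dx g e p \<Longrightarrow> g p \<noteq> 0 \<Longrightarrow>
    has_dx (\<lambda>p. f p / g p) (d / g p - (f p / g p) * (e / g p)) p"
  unfolding has_dx_def has_real_derivative_iff_has_vector_derivative[symmetric]
  by (auto intro!: derivative_eq_intros simp: field_simps)

lemma has_dt_divide:
  fixes f g :: "real \<times> real \<Rightarrow> real"
  shows "has_dt f d p \<Longrightarrow> has_dt g e p \<Longrightarrow> g p \<noteq> 0 \<Longrightarrow>
    has_dt (\<lambda>p. f p / g p) (d / g p - (f p / g p) * (e / g p)) p"
  unfolding has_dt_def has_real_derivative_iff_has_vector_derivative[symmetric]
  by (auto intro!: derivative_eq_intros simp: field_simps)

lemma mixed_partials_eq_vec:
  fixes f :: "real \<times> real \<Rightarrow> real^'n"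
  assumes S: "open S" and p: "p \<in> S" and f: "smooth_on S f"
  shows "dt (dx f) p = dx (dt f) p"
proof -
  have "dt (dx f) p $ i = dx (dt f) p $ i" for i
  proof -
    note nth = bounded_linear_vec_nth[of i]
    define g where "g = (\<lambda>p. f p $ i)"
    have g: "smooth_on S g" unfolding g_def by (rule smooth_on_linear[OF S nth f])
    have gx: "dx g p = dx f p $ i" and gt: "dt g p = dt f p $ i" if "p \<in> S" for p
      unfolding g_def
      using has_dx_imp_dx[OF has_dx_linear[OF nth smooth_on_has_dx[OF S f that]]]
        has_dt_imp_dt[OF has_dt_linear[OF nth smooth_on_has_dt[OF S f that]]] by auto
    have "dt (dx g) p = dt (dx f) p $ i"
      by (rule has_dt_imp_dt[OF has_dt_cong[OF S p gx[symmetric]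
            has_dt_linear[OF nth smooth_on_has_dt[OF S smooth_on_dx[OF S f] p]]]])
    moreover have "dx (dt g) p = dx (dt f) p $ i"
      by (rule has_dx_imp_dx[OF has_dx_cong[OF S p gt[symmetric]
            has_dx_linear[OF nth smooth_on_has_dx[OF S smooth_on_dt[OF S f] p]]]])
    ultimately show ?thesis using mixed_partials_eq[OF S p g] by simp
  qed
  then show ?thesis by (simp add: vec_eq_iff)
qed

section \<open>The frame of a central affine curve\<close>

lemma caf_solution_derivatives:
  assumes S: "open S" and caf: "caf_solution_on S \<gamma> q" and p: "p \<in> S"
  shows "has_dx \<gamma> (dx \<gamma> p) p"
    and "has_dx (dx \<gamma>) (q p *\<^sub>R \<gamma> p) p"
    and "has_dt \<gamma> ((1/4 * dx q p) *\<^sub>R \<gamma> p - (1/2 * q p) *\<^sub>R dx \<gamma> p) p"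
    and "has_dt (dx \<gamma>)
      ((1/4 * (dx (dx q) p - 2 * (q p)\<^sup>2)) *\<^sub>R \<gamma> p - (1/4 * dx q p) *\<^sub>R dx \<gamma> p) p"
proof -
  have sg: "smooth_on S \<gamma>" and sq: "smooth_on S q"
    and xx: "\<And>p. p \<in> S \<Longrightarrow> dx (dx \<gamma>) p = q p *\<^sub>R \<gamma> p"
    and t: "\<And>p. p \<in> S \<Longrightarrow> dt \<gamma> p = (1/4 * dx q p) *\<^sub>R \<gamma> p - (1/2 * q p) *\<^sub>R dx \<gamma> p"
    using caf by (auto simp: caf_solution_on_def central_affine_curvature_on_def)
  show gx: "has_dx \<gamma> (dx \<gamma> p) p" by (rule smooth_on_has_dx[OF S sg p])
  show gxx: "has_dx (dx \<gamma>) (q p *\<^sub>R \<gamma> p) p"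
    using smooth_on_has_dx[OF S smooth_on_dx[OF S sg] p] xx[OF p] by simp
  show "has_dt \<gamma> ((1/4 * dx q p) *\<^sub>R \<gamma> p - (1/2 * q p) *\<^sub>R dx \<gamma> p) p"
    using smooth_on_has_dt[OF S sg p] t[OF p] by simp
  note qx = smooth_on_has_dx[OF S sq p] smooth_on_has_dx[OF S smooth_on_dx[OF S sq] p]
  have "has_dx (dt \<gamma>) ((1/4 * (dx (dx q) p - 2 * (q p)\<^sup>2)) *\<^sub>R \<gamma> p - (1/4 * dx q p) *\<^sub>R dx \<gamma> p) p"
  proof (rule has_dx_cong[OF S p t[symmetric]])
    show "has_dx (\<lambda>p. (1/4 * dx q p) *\<^sub>R \<gamma> p - (1/2 * q p) *\<^sub>R dx \<gamma> p)
        ((1/4 * (dx (dx q) p - 2 * (q p)\<^sup>2)) *\<^sub>R \<gamma> p - (1/4 * dx q p) *\<^sub>R dx \<gamma> p) p"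
      by (rule has_dx_eq_rhs, (rule has_dx_intros gx gxx qx)+)
        (simp add: vec_eq_iff algebra_simps power2_eq_square)
  qed
  then show "has_dt (dx \<gamma>) ((1/4 * (dx (dx q) p - 2 * (q p)\<^sup>2)) *\<^sub>R \<gamma> p - (1/4 * dx q p) *\<^sub>R dx \<gamma> p) p"
    using smooth_on_has_dt[OF S smooth_on_dx[OF S sg] p] mixed_partials_eq_vec[OF S p sg] has_dx_imp_dx
    by metis
qed

definition frame :: "(real \<times> real \<Rightarrow> real^2) \<Rightarrow> real \<times> real \<Rightarrow> complex^2^2" where
  "frame \<gamma> p = cmat (cols (\<gamma> p) (dx \<gamma> p))"

lemma cmat_mat22: "cmat (mat22 a b c d) = mat22 (of_real a) (of_real b) (of_real c) (of_real d)"
  by (simp add: cmat_def map_matrix_def vec_eq_iff forall_2)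

lemma cmat_cols_nth [simp]:
  "cmat (cols u v) $ i $ 1 = of_real (u $ i)" "cmat (cols u v) $ i $ 2 = of_real (v $ i)"
  using exhaust_2[of i] by (auto simp: cols_def cmat_mat22)

lemma cmat_cols_split: "cmat (cols u v) = cmat (cols u 0) + cmat (cols 0 v)"
  by (simp add: vec_eq_iff forall_2)

lemma bounded_linear_cmat_cols:
  "bounded_linear (\<lambda>u. cmat (cols u 0))" "bounded_linear (\<lambda>v. cmat (cols 0 v))"
  by (simp_all add: linear_conv_bounded_linear[symmetric] linear_iff vec_eq_iff forall_2)
    (simp_all add: scaleR_conv_of_real[where 'a=complex])

lemma frame_split: "frame \<gamma> = (\<lambda>p. cmat (cols (\<gamma> p) 0) + cmat (cols 0 (dx \<gamma> p)))"
  by (rule ext) (simp add: frame_def cmat_cols_split[symmetric])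

text \<open>The curve flow in matrix form: it is the Lax pair at \<open>\<lambda> = 0\<close>. This serves both the given curve
  on the whole plane and the transformed curve on an open set.\<close>

lemma frame_has_derivatives:
  assumes S: "open S" and caf: "caf_solution_on S \<gamma> q" and p: "p \<in> S"
  shows "has_dx (frame \<gamma>) (frame \<gamma> p ** lax_U q p 0) p"
    and "has_dt (frame \<gamma>) (frame \<gamma> p ** lax_V q p 0) p"
proof -
  note D = caf_solution_derivatives[OF S caf p]
  note add_x = has_dx_add[OF has_dx_linear[OF bounded_linear_cmat_cols(1)] has_dx_linear[OF bounded_linear_cmat_cols(2)]]
  note add_t = has_dt_add[OF has_dt_linear[OF bounded_linear_cmat_cols(1)] has_dt_linear[OF bounded_linear_cmat_cols(2)]]
  show "has_dx (frame \<gamma>) (frame \<gamma> p ** lax_U q p 0) p"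
    by (subst (1) frame_split, rule has_dx_eq_rhs[OF add_x[OF D(1,2)]])
      (simp add: frame_def vec_eq_iff forall_2 matrix_matrix_mult_def sum_2 lax_U_def)
  show "has_dt (frame \<gamma>) (frame \<gamma> p ** lax_V q p 0) p"
    by (subst (1) frame_split, rule has_dt_eq_rhs[OF add_t[OF D(3,4)]])
      (simp add: frame_def vec_eq_iff forall_2 matrix_matrix_mult_def sum_2 lax_V_def algebra_simps)
qed

lemma smooth_on_frame:
  assumes S: "open S" and sm: "smooth_on S \<gamma>"
  shows "smooth_on S (frame \<gamma>)"
  unfolding frame_split
  by (rule smooth_on_add[OF S smooth_on_linear[OF S bounded_linear_cmat_cols(1) sm]
        smooth_on_linear[OF S bounded_linear_cmat_cols(2) smooth_on_dx[OF S sm]]])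

lemma det_frame:
  assumes "det (cols (\<gamma> p) (dx \<gamma> p)) = 1"
  shows "det (frame \<gamma> p) = 1"
proof -
  have "det (frame \<gamma> p) = complex_of_real (det (cols (\<gamma> p) (dx \<gamma> p)))"
    by (simp add: frame_def det_2) (simp add: cols_def)
  with assms show ?thesis by simp
qed

lemma extended_frame_has_dx:
  assumes "extended_frame_on S q E" "p \<in> S"
  shows "has_dx (\<lambda>p. E p z) (E p z ** lax_U q p z) p"
    and "has_dt (\<lambda>p. E p z) (E p z ** lax_V q p z) p"
  using assms by (cases p; auto simp: extended_frame_on_def has_dx_def has_dt_def)+

text \<open>The derivative of \<open>X G\<^sup>-\<^sup>1\<close> when \<open>X' = X A\<close> and \<open>G' = G B\<close>: since \<open>B\<close> is trace free, the
  adjugate turns \<open>B\<close> into \<open>-B\<close>.\<close>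

lemma relative_frame_derivative:
  fixes X G A B :: "complex^2^2"
  assumes "det G = 1" "B $ 1 $ 1 + B $ 2 $ 2 = 0"
  shows "X ** adj (G ** B) + (X ** A) ** adj G = (X ** adj G) ** (G ** (A - B) ** adj G)"
proof -
  interpret m: bounded_bilinear "(**) :: complex^2^2 \<Rightarrow> complex^2^2 \<Rightarrow> complex^2^2"
    by (rule bounded_bilinear_matrix_mult)
  have "X ** adj (G ** B) + (X ** A) ** adj G = X ** (A - B) ** adj G"
    using adj_trace_free[OF assms(2)]
    by (simp add: adj_mult m.minus_left m.minus_right m.diff_left m.diff_right matrix_mul_assoc)
  also have "\<dots> = X ** (adj G ** G) ** (A - B) ** adj G"
    by (simp add: adj_mult_left assms(1))
  finally show ?thesis by (simp add: matrix_mul_assoc)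
qed

section \<open>The first two coefficients of the extended frame\<close>

locale framed_caf_solution =
  fixes \<gamma> :: "real \<times> real \<Rightarrow> real^2" and q :: "real \<times> real \<Rightarrow> real"
    and E :: "real \<times> real \<Rightarrow> complex \<Rightarrow> complex^2^2"
  assumes caf: "caf_solution_on UNIV \<gamma> q"
    and lax: "extended_frame_on UNIV q E"
    and init: "E (0, 0) 0 = frame \<gamma> (0, 0)"
begin

lemma smooth_\<gamma>: "smooth_on UNIV \<gamma>" and smooth_q: "smooth_on UNIV q"
  using caf by (auto simp: caf_solution_on_def central_affine_curvature_on_def)

lemma det_frame_1: "det (frame \<gamma> p) = 1"
  using caf unfolding caf_solution_on_def by (intro det_frame) blast

lemmas G_derivs = frame_has_derivatives[OF open_UNIV caf UNIV_I]
lemmas E_derivs = extended_frame_has_dx[OF lax UNIV_I]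

lemma relative_frame_has_dx:
  "has_dx (\<lambda>p. E p z ** adj (frame \<gamma> p))
     ((E p z ** adj (frame \<gamma> p)) ** (frame \<gamma> p ** (lax_U q p z - lax_U q p 0) ** adj (frame \<gamma> p))) p"
  by (rule has_dx_eq_rhs[OF has_dx_matrix_mult[OF E_derivs(1) has_dx_linear[OF bounded_linear_adj G_derivs(1)]]])
    (rule relative_frame_derivative, auto simp: det_frame_1 lax_U_def)

lemma relative_frame_has_dt:
  "has_dt (\<lambda>p. E p z ** adj (frame \<gamma> p))
     ((E p z ** adj (frame \<gamma> p)) ** (frame \<gamma> p ** (lax_V q p z - lax_V q p 0) ** adj (frame \<gamma> p))) p"
  by (rule has_dt_eq_rhs[OF has_dt_matrix_mult[OF E_derivs(2) has_dt_linear[OF bounded_linear_adj G_derivs(2)]]])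
    (rule relative_frame_derivative, auto simp: det_frame_1 lax_V_def)

text \<open>At \<open>\<lambda> = 0\<close> the relative frame has vanishing derivatives, and it is the identity at the origin.\<close>

lemma frame_at_zero: "E p 0 = frame \<gamma> p"
proof -
  define D where "D p = E p 0 ** adj (frame \<gamma> p)" for p
  have "has_dx D 0 p" "has_dt D 0 p" for p
    using relative_frame_has_dx[of 0 p] relative_frame_has_dt[of 0 p]
      bounded_bilinear.zero_left[OF bounded_bilinear_matrix_mult]
      bounded_bilinear.zero_right[OF bounded_bilinear_matrix_mult]
    by (simp_all add: D_def[abs_def])
  note D0 = this
  obtain x t where p: "p = (x, t)" by fastforce
  have "D (x, t) = D (0, t)"
    by (rule has_vector_derivative_zero_constant[of UNIV "\<lambda>s. D (s, t)"])
      (use D0(1)[of "(_, t)"] in \<open>auto simp: has_dx_def\<close>)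
  also have "\<dots> = D (0, 0)"
    by (rule has_vector_derivative_zero_constant[of UNIV "\<lambda>s. D (0, s)"])
      (use D0(2)[of "(0, _)"] in \<open>auto simp: has_dt_def\<close>)
  also have "\<dots> = mat 1" by (simp add: D_def init adj_mult_right det_frame_1)
  finally have "E p 0 ** (adj (frame \<gamma> p) ** frame \<gamma> p) = frame \<gamma> p"
    by (simp add: D_def p matrix_mul_assoc)
  then show ?thesis by (simp add: adj_mult_left det_frame_1)
qed

abbreviation E1 where "E1 \<equiv> lambda_coeff E 1"

lemma holomorphic_entry: "(\<lambda>z. E p z $ i $ j) holomorphic_on UNIV"
  using lax unfolding extended_frame_on_def by blast

lemma entry_has_derivative: "((\<lambda>z. E p z $ i $ j) has_field_derivative E1 p $ i $ j) (at 0)"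
  using holomorphic_derivI[OF holomorphic_entry open_UNIV UNIV_I, of p i j 0]
  by (simp add: lambda_coeff_def)

text \<open>A real sequence of spectral parameters suffices to compute \<open>\<lambda>\<close>-derivatives at 0; being real, it
  also transfers the reality of \<open>E\<close> to \<open>E1\<close>.\<close>

abbreviation \<epsilon> :: "nat \<Rightarrow> real" where "\<epsilon> n \<equiv> inverse (real (Suc n))"

lemma difference_quotient_tendsto_E1: "(\<lambda>n. (E p (of_real (\<epsilon> n)) - E p 0) /\<^sub>R \<epsilon> n) \<longlonglongrightarrow> E1 p"
proof (intro vec_tendstoI)
  fix i j
  have "(\<lambda>n. complex_of_real (\<epsilon> n)) \<longlonglongrightarrow> of_real 0"
    by (intro tendsto_of_real LIMSEQ_inverse_real_of_nat)
  then have "filterlim (\<lambda>n. complex_of_real (\<epsilon> n)) (at 0) sequentially"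
    by (auto simp: filterlim_at simp del: of_nat_Suc)
  moreover have "((\<lambda>h. (E p (0 + h) $ i $ j - E p 0 $ i $ j) / h) \<longlongrightarrow> E1 p $ i $ j) (at 0)"
    using entry_has_derivative[of p i j] unfolding DERIV_def .
  ultimately have "((\<lambda>n. (E p (0 + of_real (\<epsilon> n)) $ i $ j - E p 0 $ i $ j) / of_real (\<epsilon> n)) \<longlonglongrightarrow> E1 p $ i $ j)"
    by (rule filterlim_compose[rotated])
  then show "(\<lambda>n. ((E p (of_real (\<epsilon> n)) - E p 0) /\<^sub>R \<epsilon> n) $ i $ j) \<longlonglongrightarrow> E1 p $ i $ j"
    by (simp add: scaleR_conv_of_real[where 'a=complex] divide_inverse mult.commute)
qed

lemma E1_real: "E1 p $ i $ j \<in> \<real>"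
proof (rule closed_sequentially[OF closed_complex_Reals])
  have "cnj (E p (of_real c) $ i $ j) = E p (of_real c) $ i $ j" for c
  proof -
    have "cnj_mat (E p (cnj (of_real c))) = E p (of_real c)"
      using lax unfolding extended_frame_on_def by blast
    then have "cnj_mat (E p (of_real c)) $ i $ j = E p (of_real c) $ i $ j" by simp
    then show ?thesis by (simp add: cnj_mat_def map_matrix_def)
  qed
  then have "E p (of_real c) $ i $ j \<in> \<real>" for c by (simp add: Reals_cnj_iff)
  from this this[of 0]
  show "((E p (of_real (\<epsilon> n)) - E p 0) /\<^sub>R \<epsilon> n) $ i $ j \<in> \<real>" for n
    by (auto simp: scaleR_conv_of_real[where 'a=complex] simp del: of_nat_Suc of_real_inverse
        intro!: Reals_mult Reals_diff)
  show "(\<lambda>n. ((E p (of_real (\<epsilon> n)) - E p 0) /\<^sub>R \<epsilon> n) $ i $ j) \<longlonglongrightarrow> E1 p $ i $ j"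
    by (intro tendsto_vec_nth difference_quotient_tendsto_E1)
qed

lemma relative_coefficient_limit:
  "(\<lambda>n. (E p (of_real (\<epsilon> n)) ** adj (frame \<gamma> p) - mat 1) /\<^sub>R \<epsilon> n) \<longlonglongrightarrow> E1 p ** adj (frame \<gamma> p)"
proof -
  interpret m: bounded_bilinear "(**) :: complex^2^2 \<Rightarrow> complex^2^2 \<Rightarrow> complex^2^2"
    by (rule bounded_bilinear_matrix_mult)
  have "(\<lambda>n. ((E p (of_real (\<epsilon> n)) - E p 0) /\<^sub>R \<epsilon> n) ** adj (frame \<gamma> p)) \<longlonglongrightarrow> E1 p ** adj (frame \<gamma> p)"
    by (intro m.tendsto difference_quotient_tendsto_E1 tendsto_const)
  then show ?thesis
    by (simp add: m.scaleR_left m.diff_left frame_at_zero adj_mult_right det_frame_1)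
qed

text \<open>The \<open>\<lambda>\<close>-derivative of \<open>lax_V\<close> at 0; that of \<open>lax_U\<close> is \<open>e12\<close>.\<close>

definition dlax_V :: "real \<times> real \<Rightarrow> complex^2^2" where
  "dlax_V p = mat22 0 (of_real (q p / 2)) 1 0"

lemma lax_U_increment: "lax_U q p (of_real c) - lax_U q p 0 = c *\<^sub>R e12"
  by (simp add: lax_U_def e12_def vec_eq_iff forall_2 scaleR_conv_of_real[where 'a=complex])

lemma lax_V_increment: "lax_V q p (of_real c) - lax_V q p 0 = c *\<^sub>R (dlax_V p + c *\<^sub>R e12)"
  by (simp add: lax_V_def dlax_V_def e12_def vec_eq_iff forall_2 scaleR_conv_of_real[where 'a=complex] power2_eq_square algebra_simps)

lemma smooth_dlax_V: "smooth_on UNIV dlax_V"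
proof -
  have "bounded_linear (\<lambda>c :: real. mat22 0 (complex_of_real (c / 2)) 0 0)"
    by (simp add: linear_conv_bounded_linear[symmetric] linear_iff vec_eq_iff forall_2 scaleR_conv_of_real[where 'a=complex]
        add_divide_distrib)
  then have "smooth_on UNIV (\<lambda>p. mat22 0 (complex_of_real (q p / 2)) 0 0 + mat22 0 0 1 0)"
    by (rule smooth_on_add[OF open_UNIV smooth_on_linear[OF open_UNIV _ smooth_q] smooth_on_const[OF open_UNIV]])
  then show ?thesis by (simp add: dlax_V_def[abs_def] mat22_add)
qed

lemmas smooth_matrix_mult = smooth_on_bilinear[OF open_UNIV bounded_bilinear_matrix_mult]

lemma smooth_frame: "smooth_on UNIV (frame \<gamma>)"
  by (rule smooth_on_frame[OF open_UNIV smooth_\<gamma>])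

lemma smooth_conjugate: "smooth_on UNIV A \<Longrightarrow> smooth_on UNIV (\<lambda>p. frame \<gamma> p ** A p ** adj (frame \<gamma> p))"
  by (intro smooth_matrix_mult smooth_frame smooth_on_linear[OF open_UNIV bounded_linear_adj])

text \<open>Passing to \<open>E1 G\<^sup>-\<^sup>1\<close> is what makes the regularity argument work: unlike the
  derivatives of \<open>E1\<close>, these right-hand sides do not contain \<open>E1\<close> and are visibly smooth.\<close>

lemma relative_coefficient_derivatives:
  shows "has_dx (\<lambda>p. E1 p ** adj (frame \<gamma> p)) (frame \<gamma> p ** e12 ** adj (frame \<gamma> p)) p"
    and "has_dt (\<lambda>p. E1 p ** adj (frame \<gamma> p)) (frame \<gamma> p ** dlax_V p ** adj (frame \<gamma> p)) p"
proof -
  interpret m: bounded_bilinear "(**) :: complex^2^2 \<Rightarrow> complex^2^2 \<Rightarrow> complex^2^2"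
    by (rule bounded_bilinear_matrix_mult)
  let ?C = "\<lambda>A p. frame \<gamma> p ** A p ** adj (frame \<gamma> p)"
  have cont: "continuous_on UNIV (?C A)" if "smooth_on UNIV A" for A
    by (rule smooth_on_imp_continuous_on[OF open_UNIV smooth_conjugate[OF that]])
  have cx: "continuous_on UNIV (\<lambda>s. ?C A (s, t))" if "smooth_on UNIV A" for A t
    by (rule continuous_on_compose2[OF cont[OF that]]) (auto intro!: continuous_intros)
  have ct: "continuous_on UNIV (\<lambda>s. ?C A (x, s))" if "smooth_on UNIV A" for A x
    by (rule continuous_on_compose2[OF cont[OF that]]) (auto intro!: continuous_intros)
  note eps = LIMSEQ_inverse_real_of_nat
  obtain x t where p: "p = (x, t)" by fastforce
  have "((\<lambda>s. E1 (s, t) ** adj (frame \<gamma> (s, t))) has_vector_derivative ?C (\<lambda>_. e12) (x, t)) (at x)"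
  proof (rule first_order_variation[OF _ _ eps _ cx continuous_on_const[of _ 0] relative_coefficient_limit])
    fix n s
    show "((\<lambda>s. E (s, t) (of_real (\<epsilon> n)) ** adj (frame \<gamma> (s, t))) has_vector_derivative
      \<epsilon> n *\<^sub>R (E (s, t) (of_real (\<epsilon> n)) ** adj (frame \<gamma> (s, t)) ** (?C (\<lambda>_. e12) (s, t) + \<epsilon> n *\<^sub>R 0))) (at s)"
      using relative_frame_has_dx[of "of_real (\<epsilon> n)" "(s, t)"]
      by (simp add: has_dx_def lax_U_increment m.scaleR_left m.scaleR_right del: of_real_inverse of_nat_Suc)
  qed (auto intro: smooth_on_const simp: inverse_le_1_iff)
  then show "has_dx (\<lambda>p. E1 p ** adj (frame \<gamma> p)) (?C (\<lambda>_. e12) p) p"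
    by (simp add: has_dx_def p)
  have "((\<lambda>s. E1 (x, s) ** adj (frame \<gamma> (x, s))) has_vector_derivative ?C dlax_V (x, t)) (at t)"
  proof (rule first_order_variation[OF _ _ eps _ ct ct relative_coefficient_limit])
    fix n s
    show "((\<lambda>s. E (x, s) (of_real (\<epsilon> n)) ** adj (frame \<gamma> (x, s))) has_vector_derivative
      \<epsilon> n *\<^sub>R (E (x, s) (of_real (\<epsilon> n)) ** adj (frame \<gamma> (x, s)) **
        (?C dlax_V (x, s) + \<epsilon> n *\<^sub>R ?C (\<lambda>_. e12) (x, s)))) (at s)"
      using relative_frame_has_dt[of "of_real (\<epsilon> n)" "(x, s)"]
      by (simp add: has_dt_def lax_V_increment m.scaleR_left m.scaleR_right m.add_left m.add_right
          del: of_real_inverse of_nat_Suc)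
  qed (auto intro: smooth_on_const smooth_dlax_V simp: inverse_le_1_iff)
  then show "has_dt (\<lambda>p. E1 p ** adj (frame \<gamma> p)) (?C dlax_V p) p"
    by (simp add: has_dt_def p)
qed

lemma E1_eq: "E1 p = (E1 p ** adj (frame \<gamma> p)) ** frame \<gamma> p"
  by (simp add: matrix_mul_assoc[symmetric] adj_mult_left det_frame_1)

lemma smooth_E1: "smooth_on UNIV E1"
proof -
  have "smooth_on UNIV (\<lambda>p. E1 p ** adj (frame \<gamma> p))"
    by (rule smooth_of_partials[OF relative_coefficient_derivatives])
      (intro smooth_conjugate smooth_on_const smooth_dlax_V open_UNIV)+
  from smooth_matrix_mult[OF this smooth_frame]
  show ?thesis unfolding E1_eq[symmetric] .
qed

text \<open>These are the equations of \<open>E\<close> differentiated with respect to \<open>\<lambda>\<close> at 0.\<close>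

lemma E1_derivatives:
  shows "has_dx E1 (E1 p ** lax_U q p 0 + frame \<gamma> p ** e12) p"
    and "has_dt E1 (E1 p ** lax_V q p 0 + frame \<gamma> p ** dlax_V p) p"
proof -
  have unconj: "(frame \<gamma> p ** A ** adj (frame \<gamma> p)) ** frame \<gamma> p = frame \<gamma> p ** A" for A
    by (simp add: matrix_mul_assoc[symmetric] adj_mult_left det_frame_1)
  have eq: "E1 = (\<lambda>p. (E1 p ** adj (frame \<gamma> p)) ** frame \<gamma> p)"
    by (rule ext) (rule E1_eq)
  show "has_dx E1 (E1 p ** lax_U q p 0 + frame \<gamma> p ** e12) p"
    by (subst (1) eq, rule has_dx_eq_rhs[OF has_dx_matrix_mult[OF relative_coefficient_derivatives(1) G_derivs(1)]])
      (simp only: unconj matrix_mul_assoc E1_eq[symmetric])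
  show "has_dt E1 (E1 p ** lax_V q p 0 + frame \<gamma> p ** dlax_V p) p"
    by (subst (1) eq, rule has_dt_eq_rhs[OF has_dt_matrix_mult[OF relative_coefficient_derivatives(2) G_derivs(2)]])
      (simp only: unconj matrix_mul_assoc E1_eq[symmetric])
qed

lemma lambda_coeff_0: "lambda_coeff E 0 p = E p 0"
  by (simp add: lambda_coeff_def vec_eq_iff)

lemma power_series: "(\<lambda>n. smult_mat (z ^ n) (lambda_coeff E n p)) sums E p z"
  unfolding sums_def
proof (intro vec_tendstoI)
  fix i j
  have "(\<lambda>n. (deriv ^^ n) (\<lambda>z. E p z $ i $ j) 0 / fact n * (z - 0) ^ n) sums E p z $ i $ j"
    by (rule holomorphic_power_series[where r = "norm z + 1"])
      (auto intro: holomorphic_on_subset[OF holomorphic_entry])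
  then show "(\<lambda>n. (\<Sum>n<n. smult_mat (z ^ n) (lambda_coeff E n p)) $ i $ j) \<longlonglongrightarrow> E p z $ i $ j"
    by (simp add: sums_def sum_component smult_mat_def map_matrix_def lambda_coeff_def mult.commute)
qed

end

section \<open>Entrywise calculus of matrix functions\<close>

lemma has_derivs_mat22:
  fixes a b c d :: "real \<times> real \<Rightarrow> complex"
  shows "has_dx a a' p \<Longrightarrow> has_dx b b' p \<Longrightarrow> has_dx c c' p \<Longrightarrow> has_dx d d' p \<Longrightarrow>
      has_dx (\<lambda>p. mat22 (a p) (b p) (c p) (d p)) (mat22 a' b' c' d') p"
    and "has_dt a a' p \<Longrightarrow> has_dt b b' p \<Longrightarrow> has_dt c c' p \<Longrightarrow> has_dt d d' p \<Longrightarrow>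
      has_dt (\<lambda>p. mat22 (a p) (b p) (c p) (d p)) (mat22 a' b' c' d') p"
proof -
  have L: "bounded_linear (\<lambda>z :: complex. mat22 z 0 0 0)" "bounded_linear (\<lambda>z :: complex. mat22 0 z 0 0)"
    "bounded_linear (\<lambda>z :: complex. mat22 0 0 z 0)" "bounded_linear (\<lambda>z :: complex. mat22 0 0 0 z)"
    by (simp_all add: linear_conv_bounded_linear[symmetric] linear_iff vec_eq_iff forall_2)
  have split: "mat22 x y z u = mat22 x 0 0 0 + mat22 0 y 0 0 + mat22 0 0 z 0 + mat22 0 0 0 u" for x y z u :: complex
    by (simp add: mat22_add)
  note dx = has_dx_add[OF has_dx_add[OF has_dx_add[OF has_dx_linear[OF L(1)] has_dx_linear[OF L(2)]]
        has_dx_linear[OF L(3)]] has_dx_linear[OF L(4)]]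
  note dt = has_dt_add[OF has_dt_add[OF has_dt_add[OF has_dt_linear[OF L(1)] has_dt_linear[OF L(2)]]
        has_dt_linear[OF L(3)]] has_dt_linear[OF L(4)]]
  show "has_dx a a' p \<Longrightarrow> has_dx b b' p \<Longrightarrow> has_dx c c' p \<Longrightarrow> has_dx d d' p \<Longrightarrow>
      has_dx (\<lambda>p. mat22 (a p) (b p) (c p) (d p)) (mat22 a' b' c' d') p"
    using dx[of a a' p b b' c c' d d'] by (simp add: mat22_add)
  show "has_dt a a' p \<Longrightarrow> has_dt b b' p \<Longrightarrow> has_dt c c' p \<Longrightarrow> has_dt d d' p \<Longrightarrow>
      has_dt (\<lambda>p. mat22 (a p) (b p) (c p) (d p)) (mat22 a' b' c' d') p"
    using dt[of a a' p b b' c c' d d'] by (simp add: mat22_add)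
qed

lemma matrix_mult_entry_derivative:
  fixes A B :: "complex \<Rightarrow> complex^2^2"
  assumes "\<And>i j. ((\<lambda>z. A z $ i $ j) has_field_derivative A' $ i $ j) (at z)"
    and "\<And>i j. ((\<lambda>z. B z $ i $ j) has_field_derivative B' $ i $ j) (at z)"
  shows "((\<lambda>z. (A z ** B z) $ i $ j) has_field_derivative (A z ** B' + A' ** B z) $ i $ j) (at z)"
  unfolding matrix_matrix_mult_def sum_2
  by (auto intro!: derivative_eq_intros assms simp: algebra_simps)

lemma r0_entry_derivative: "((\<lambda>z. r0 c z $ i $ j) has_field_derivative e12 $ i $ j) (at z)"
proof -
  have "\<forall>i j. ((\<lambda>z. r0 c z $ i $ j) has_field_derivative e12 $ i $ j) (at z)"
    unfolding forall_2 r0_def e12_def mat22_nth by (auto intro!: derivative_eq_intros)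
  then show ?thesis by blast
qed

definition re_col :: "2 \<Rightarrow> complex^2^2 \<Rightarrow> real^2" where
  "re_col j A = (\<chi> i. Re (A $ i $ j))"

lemma bounded_linear_re_col: "bounded_linear (re_col j)"
  by (simp add: linear_conv_bounded_linear[symmetric] linear_iff re_col_def vec_eq_iff)

section \<open>The Darboux transformation\<close>

locale darboux = framed_caf_solution +
  fixes \<xi> :: real and \<Omega> :: "(real \<times> real) set"
  assumes open_\<Omega>: "open \<Omega>" and nonzero: "\<And>p. p \<in> \<Omega> \<Longrightarrow> vector [1, \<xi>] \<bullet> \<gamma> p \<noteq> 0"
begin

text \<open>The suffix \<open>D\<close> marks transformed quantities. The function \<open>w\<close> solves the same linear
  equations as the components of \<open>\<gamma>\<close>, and \<open>\<xi>D\<close> is its logarithmic \<open>x\<close>-derivative.\<close>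

definition w where "w p = vector [1, \<xi>] \<bullet> \<gamma> p"
definition wx where "wx p = vector [1, \<xi>] \<bullet> dx \<gamma> p"
abbreviation \<xi>D where "\<xi>D \<equiv> xi_tilde \<xi> \<gamma>"
abbreviation v :: "real^2" where "v \<equiv> vector [\<xi>, 1]"
definition qD where "qD p = - q p + 2 * (\<xi>D p)\<^sup>2"

lemma w_nonzero: "p \<in> \<Omega> \<Longrightarrow> w p \<noteq> 0" using nonzero by (simp add: w_def)

lemma \<xi>D_eq: "\<xi>D = (\<lambda>p. wx p / w p)"
  by (rule ext) (simp add: xi_tilde_def w_def wx_def)

lemma wx_eq: "p \<in> \<Omega> \<Longrightarrow> wx p = \<xi>D p * w p"
  by (simp add: \<xi>D_eq w_nonzero)

lemmas \<gamma>_derivs = caf_solution_derivatives[OF open_UNIV caf UNIV_I]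
lemmas q_x = smooth_on_has_dx[OF open_UNIV smooth_q UNIV_I]
lemmas smooth_qx = smooth_on_dx[OF open_UNIV smooth_q]
lemmas smooth_qxx = smooth_on_dx[OF open_UNIV smooth_qx]
lemmas q_xx = smooth_on_has_dx[OF open_UNIV smooth_qx UNIV_I]
lemmas q_xxx = smooth_on_has_dx[OF open_UNIV smooth_qxx UNIV_I]
lemmas q_t = smooth_on_has_dt[OF open_UNIV smooth_q UNIV_I]

lemma w_derivs:
  shows "has_dx w (wx p) p" and "has_dx wx (q p * w p) p"
    and "has_dt w (1/4 * dx q p * w p - 1/2 * q p * wx p) p"
    and "has_dt wx (1/4 * (dx (dx q) p - 2 * (q p)\<^sup>2) * w p - 1/4 * dx q p * wx p) p"
proof -
  note l = bounded_linear_inner_right[of "vector [1, \<xi>] :: real^2"]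
  show "has_dx w (wx p) p" "has_dx wx (q p * w p) p"
    "has_dt w (1/4 * dx q p * w p - 1/2 * q p * wx p) p"
    "has_dt wx (1/4 * (dx (dx q) p - 2 * (q p)\<^sup>2) * w p - 1/4 * dx q p * wx p) p"
    using has_dx_linear[OF l \<gamma>_derivs(1)[of p]] has_dx_linear[OF l \<gamma>_derivs(2)[of p]]
      has_dt_linear[OF l \<gamma>_derivs(3)[of p]] has_dt_linear[OF l \<gamma>_derivs(4)[of p]]
    unfolding w_def[abs_def] wx_def[abs_def] by (simp_all add: inner_diff_right)
qed

text \<open>The Riccati equation for a logarithmic derivative, and its companion in \<open>t\<close>.\<close>

lemma \<xi>D_derivs:
  assumes p: "p \<in> \<Omega>"
  shows "has_dx \<xi>D (q p - \<xi>D p * \<xi>D p) p"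
    and "has_dt \<xi>D (1/4 * dx (dx q) p - 1/2 * q p * q p - 1/2 * dx q p * \<xi>D p + 1/2 * q p * \<xi>D p * \<xi>D p) p"
proof -
  note w0 = w_nonzero[OF p]
  show "has_dx \<xi>D (q p - \<xi>D p * \<xi>D p) p"
    by (subst (1) \<xi>D_eq, rule has_dx_eq_rhs[OF has_dx_divide[OF w_derivs(2) w_derivs(1) w0]])
      (use w0 in \<open>simp add: \<xi>D_eq\<close>)
  show "has_dt \<xi>D (1/4 * dx (dx q) p - 1/2 * q p * q p - 1/2 * dx q p * \<xi>D p + 1/2 * q p * \<xi>D p * \<xi>D p) p"
    by (subst (1) \<xi>D_eq, rule has_dt_eq_rhs[OF has_dt_divide[OF w_derivs(4) w_derivs(3) w0]])
      (use w0 in \<open>simp add: wx_eq[OF p] field_simps power2_eq_square\<close>)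
qed

lemma smooth_\<xi>D: "smooth_on \<Omega> \<xi>D"
proof -
  note l = bounded_linear_inner_right[of "vector [1, \<xi>] :: real^2"]
  have "smooth_on \<Omega> w" "smooth_on \<Omega> wx"
    unfolding w_def[abs_def] wx_def[abs_def]
    by (rule smooth_on_subset[OF smooth_on_linear[OF open_UNIV l]],
        rule smooth_\<gamma> smooth_on_dx[OF open_UNIV smooth_\<gamma>], simp)+
  then show ?thesis
    unfolding \<xi>D_eq divide_inverse
    by (intro smooth_on_mult[OF open_\<Omega>] smooth_on_inverse[OF open_\<Omega>] w_nonzero)
qed

lemma smooth_qD: "smooth_on \<Omega> qD"
proof -
  have "smooth_on \<Omega> (\<lambda>p. - q p + 2 * (\<xi>D p * \<xi>D p))"
    by (intro smooth_on_add[OF open_\<Omega>] smooth_on_minus[OF open_\<Omega>] smooth_on_mult[OF open_\<Omega>]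
        smooth_on_const[OF open_\<Omega>] smooth_\<xi>D smooth_on_subset[OF smooth_q]) simp
  then show ?thesis by (simp add: qD_def[abs_def] power2_eq_square)
qed

text \<open>The \<open>x\<close>-derivatives of \<open>qD\<close>, expressed in \<open>q\<close>, its derivatives and \<open>\<xi>D\<close> by means of the Riccati
  equation.\<close>

definition qD1 where "qD1 p = - dx q p + 4 * \<xi>D p * (q p - \<xi>D p * \<xi>D p)"
definition qD2 where
  "qD2 p = - dx (dx q) p + 4 * (q p - \<xi>D p * \<xi>D p) * (q p - \<xi>D p * \<xi>D p)
    + 4 * \<xi>D p * (dx q p - 2 * \<xi>D p * (q p - \<xi>D p * \<xi>D p))"
definition qD3 where
  "qD3 p = - dx (dx (dx q)) p + 12 * (q p - \<xi>D p * \<xi>D p) * (dx q p - 2 * \<xi>D p * (q p - \<xi>D p * \<xi>D p))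
    + 4 * \<xi>D p * (dx (dx q) p - 2 * (q p - \<xi>D p * \<xi>D p) * (q p - \<xi>D p * \<xi>D p)
      - 2 * \<xi>D p * (dx q p - 2 * \<xi>D p * (q p - \<xi>D p * \<xi>D p)))"

lemma qD_derivs:
  assumes p: "p \<in> \<Omega>"
  shows "has_dx qD (qD1 p) p" and "has_dx qD1 (qD2 p) p" and "has_dx qD2 (qD3 p) p"
    and "has_dt qD (- dt q p + 4 * \<xi>D p *
      (1/4 * dx (dx q) p - 1/2 * q p * q p - 1/2 * dx q p * \<xi>D p + 1/2 * q p * \<xi>D p * \<xi>D p)) p"
  unfolding qD_def[abs_def] power2_eq_square
  subgoal
    by (rule has_dx_eq_rhs, (rule has_dx_intros q_x \<xi>D_derivs[OF p])+)
      (simp add: qD1_def algebra_simps)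
  subgoal
    unfolding qD1_def[abs_def]
    by (rule has_dx_eq_rhs, (rule has_dx_intros q_x q_xx \<xi>D_derivs[OF p])+)
      (simp add: qD2_def algebra_simps)
  subgoal
    unfolding qD2_def[abs_def]
    by (rule has_dx_eq_rhs, (rule has_dx_intros q_x q_xx q_xxx \<xi>D_derivs[OF p])+)
      (simp add: qD3_def algebra_simps)
  subgoal
    by (rule has_dt_eq_rhs, (rule has_dt_intros q_t \<xi>D_derivs[OF p])+)
      (simp add: algebra_simps)
  done

lemma dx_qD:
  assumes p: "p \<in> \<Omega>"
  shows "dx qD p = qD1 p" and "dx (dx qD) p = qD2 p" and "dx (dx (dx qD)) p = qD3 p"
proof -
  have 1: "dx qD p = qD1 p" if "p \<in> \<Omega>" for p
    by (rule has_dx_imp_dx[OF qD_derivs(1)[OF that]])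
  have 2: "dx (dx qD) p = qD2 p" if "p \<in> \<Omega>" for p
    by (rule has_dx_imp_dx[OF has_dx_cong[OF open_\<Omega> that 1[symmetric] qD_derivs(2)[OF that]]])
  show "dx qD p = qD1 p" "dx (dx qD) p = qD2 p" by (rule 1 2, rule p)+
  show "dx (dx (dx qD)) p = qD3 p"
    by (rule has_dx_imp_dx[OF has_dx_cong[OF open_\<Omega> p 2[symmetric] qD_derivs(3)[OF p]]])
qed

text \<open>Once the Riccati equation has eliminated all derivatives of \<open>\<xi>D\<close>, the KdV equation for \<open>qD\<close> is a
  polynomial consequence of the one for \<open>q\<close>.\<close>

lemma kdv_qD: "kdv_solution_on \<Omega> qD"
  unfolding kdv_solution_on_def
proof (intro conjI ballI smooth_qD)
  fix p assume p: "p \<in> \<Omega>"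
  have "dt q p = 1/4 * (dx (dx (dx q)) p - 6 * q p * dx q p)"
    using lax unfolding extended_frame_on_def kdv_solution_on_def by blast
  then show "dt qD p = 1/4 * (dx (dx (dx qD)) p - 6 * qD p * dx qD p)"
    unfolding has_dt_imp_dt[OF qD_derivs(4)[OF p]] dx_qD[OF p]
    by (simp add: qD1_def qD3_def qD_def power2_eq_square field_simps)
qed

definition R :: "complex^2^2" where "R = cmat (mat22 \<xi> (\<xi>\<^sup>2) 1 \<xi>)"

text \<open>The \<open>\<lambda>\<close>-derivative at 0 of \<open>r0 \<xi> \<lambda> E(\<lambda>)\<close>. It is real, and the new curve is the combination
  of its columns \<open>k1\<close> and \<open>k2\<close> with coefficients \<open>-\<xi>D\<close> and 1.\<close>

definition M where "M p = e12 ** frame \<gamma> p + R ** E1 p"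
definition k1 where "k1 p = re_col 1 (M p)"
definition k2 where "k2 p = re_col 2 (M p)"
definition \<gamma>D where "\<gamma>D p = k2 p - \<xi>D p *\<^sub>R k1 p"

lemma R_eq: "R = mat22 (of_real \<xi>) (of_real (\<xi>\<^sup>2)) 1 (of_real \<xi>)"
  by (simp add: R_def cmat_mat22)

text \<open>The matrix \<open>R\<close> is the rank one product \<open>(\<xi>,1)\<^sup>T (1,\<xi>)\<close>.\<close>

lemma R_frame: "R ** frame \<gamma> p = cmat (cols (w p *\<^sub>R v) (wx p *\<^sub>R v))"
  by (simp add: vec_eq_iff forall_2 matrix_matrix_mult_def sum_2 R_eq frame_def w_def wx_def inner_vec_def
      power2_eq_square algebra_simps)

lemma M_real: "M p = cmat (cols (k1 p) (k2 p))"
proof -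
  have "Im (E1 p $ i $ j) = 0" for i j
    using E1_real[of p i j] by (simp add: complex_is_Real_iff)
  then show ?thesis
    by (simp add: vec_eq_iff forall_2 k1_def k2_def re_col_def complex_eq_iff)
      (simp add: M_def matrix_matrix_mult_def sum_2 e12_def R_eq frame_def)
qed

text \<open>\<open>M\<close> satisfies the equations of \<open>G\<close> up to an inhomogeneous term coming from \<open>E1\<close>; by
  \<open>R_frame\<close> this term is a multiple of \<open>(\<xi>,1)\<^sup>T\<close>.\<close>

lemma M_derivs:
  shows "has_dx M (M p ** lax_U q p 0 + R ** frame \<gamma> p ** e12) p"
    and "has_dt M (M p ** lax_V q p 0 + R ** frame \<gamma> p ** dlax_V p) p"
proof -
  interpret m: bounded_bilinear "(**) :: complex^2^2 \<Rightarrow> complex^2^2 \<Rightarrow> complex^2^2"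
    by (rule bounded_bilinear_matrix_mult)
  show "has_dx M (M p ** lax_U q p 0 + R ** frame \<gamma> p ** e12) p"
    unfolding M_def[abs_def]
    by (rule has_dx_eq_rhs[OF has_dx_add[OF has_dx_linear[OF m.bounded_linear_right G_derivs(1)]
            has_dx_linear[OF m.bounded_linear_right E1_derivatives(1)]]])
      (simp add: m.add_left m.add_right matrix_mul_assoc)
  show "has_dt M (M p ** lax_V q p 0 + R ** frame \<gamma> p ** dlax_V p) p"
    unfolding M_def[abs_def]
    by (rule has_dt_eq_rhs[OF has_dt_add[OF has_dt_linear[OF m.bounded_linear_right G_derivs(2)]
            has_dt_linear[OF m.bounded_linear_right E1_derivatives(2)]]])
      (simp add: m.add_left m.add_right matrix_mul_assoc)
qed

lemma k_derivs:
  shows "has_dx k1 (k2 p) p" and "has_dx k2 (q p *\<^sub>R k1 p + w p *\<^sub>R v) p"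
    and "has_dt k1 ((1/4 * dx q p) *\<^sub>R k1 p - (1/2 * q p) *\<^sub>R k2 p + wx p *\<^sub>R v) p"
    and "has_dt k2 ((1/4 * (dx (dx q) p - 2 * (q p)\<^sup>2)) *\<^sub>R k1 p - (1/4 * dx q p) *\<^sub>R k2 p
      + (1/2 * q p * w p) *\<^sub>R v) p"
  unfolding k1_def[abs_def] k2_def[abs_def]
  by (rule has_dx_eq_rhs[OF has_dx_linear[OF bounded_linear_re_col M_derivs(1)]]
      has_dt_eq_rhs[OF has_dt_linear[OF bounded_linear_re_col M_derivs(2)]],
      unfold R_frame, simp add: vec_eq_iff forall_2 re_col_def matrix_matrix_mult_def sum_2
        lax_U_def lax_V_def e12_def dlax_V_def algebra_simps)+

lemma smooth_k: "smooth_on UNIV k1" "smooth_on UNIV k2"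
proof -
  have M: "smooth_on UNIV M"
    unfolding M_def[abs_def]
    by (intro smooth_on_add[OF open_UNIV] smooth_matrix_mult smooth_on_const[OF open_UNIV] smooth_frame smooth_E1)
  show "smooth_on UNIV k1" "smooth_on UNIV k2"
    unfolding k1_def[abs_def] k2_def[abs_def]
    by (rule smooth_on_linear[OF open_UNIV bounded_linear_re_col M])+
qed

lemma smooth_\<gamma>D: "smooth_on \<Omega> \<gamma>D"
proof -
  have "smooth_on \<Omega> (\<lambda>p. k2 p + - (\<xi>D p *\<^sub>R k1 p))"
    by (intro smooth_on_add[OF open_\<Omega>] smooth_on_minus[OF open_\<Omega>] smooth_\<xi>D
        smooth_on_bilinear[OF open_\<Omega> bounded_bilinear_scaleR]
        smooth_on_subset[OF smooth_k(1)] smooth_on_subset[OF smooth_k(2)]) auto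
  then show ?thesis by (simp add: \<gamma>D_def[abs_def])
qed

text \<open>In both directions the contributions of \<open>k1\<close> and \<open>k2\<close> recombine to a multiple of \<open>\<gamma>D\<close> itself,
  because \<open>u = (-\<xi>D, 1)\<^sup>T\<close> has \<open>U u + u\<^sub>x\<close> and \<open>V u + u\<^sub>t\<close> proportional to \<open>u\<close>, where \<open>U\<close> and \<open>V\<close> are the
  Lax matrices of \<open>q\<close> at \<open>\<lambda> = 0\<close>.\<close>

lemma \<gamma>D_derivs:
  assumes p: "p \<in> \<Omega>"
  shows "has_dx \<gamma>D (w p *\<^sub>R v - \<xi>D p *\<^sub>R \<gamma>D p) p"
    and "has_dt \<gamma>D ((1/2 * q p * \<xi>D p - 1/4 * dx q p) *\<^sub>R \<gamma>D p + ((1/2 * q p - \<xi>D p * \<xi>D p) * w p) *\<^sub>R v) p"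
  unfolding \<gamma>D_def[abs_def]
  subgoal
    by (rule has_dx_eq_rhs, (rule has_dx_intros k_derivs \<xi>D_derivs[OF p])+)
      (simp add: vec_eq_iff algebra_simps)
  subgoal
    by (rule has_dt_eq_rhs, (rule has_dt_intros k_derivs \<xi>D_derivs[OF p])+)
      (simp add: vec_eq_iff algebra_simps power2_eq_square wx_eq[OF p])
  done

lemma dx_\<gamma>D: "p \<in> \<Omega> \<Longrightarrow> dx \<gamma>D p = w p *\<^sub>R v - \<xi>D p *\<^sub>R \<gamma>D p"
  by (rule has_dx_imp_dx[OF \<gamma>D_derivs(1)])

lemma dx_dx_\<gamma>D:
  assumes p: "p \<in> \<Omega>"
  shows "dx (dx \<gamma>D) p = qD p *\<^sub>R \<gamma>D p"
proof (rule has_dx_imp_dx[OF has_dx_cong[OF open_\<Omega> p dx_\<gamma>D[symmetric]]])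
  show "has_dx (\<lambda>p. w p *\<^sub>R v - \<xi>D p *\<^sub>R \<gamma>D p) (qD p *\<^sub>R \<gamma>D p) p"
    by (rule has_dx_eq_rhs, (rule has_dx_intros w_derivs \<gamma>D_derivs[OF p] \<xi>D_derivs[OF p])+)
      (simp add: vec_eq_iff algebra_simps power2_eq_square wx_eq[OF p] qD_def)
qed

text \<open>The row vector \<open>(1,-\<xi>)\<close> annihilates \<open>R\<close>, so in this direction \<open>M\<close> does not see \<open>E1\<close>. This
  is why the determinant of the new frame can be computed from \<open>\<gamma>\<close> alone.\<close>

lemma k_component:
  shows "k1 p $ 1 - \<xi> * k1 p $ 2 = \<gamma> p $ 2" and "k2 p $ 1 - \<xi> * k2 p $ 2 = dx \<gamma> p $ 2"
  by (simp_all add: k1_def k2_def re_col_def M_def matrix_matrix_mult_def sum_2 e12_def R_eq frame_def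
      power2_eq_square algebra_simps)

lemma det_\<gamma>D:
  assumes p: "p \<in> \<Omega>"
  shows "det (cols (\<gamma>D p) (dx \<gamma>D p)) = 1"
proof -
  have "det (cols (\<gamma>D p) (dx \<gamma>D p)) = w p * (\<gamma>D p $ 1 - \<xi> * \<gamma>D p $ 2)"
    by (simp add: det_2 cols_def dx_\<gamma>D[OF p] algebra_simps)
  also have "\<gamma>D p $ 1 - \<xi> * \<gamma>D p $ 2 = dx \<gamma> p $ 2 - \<xi>D p * \<gamma> p $ 2"
    using k_component[of p] by (simp add: \<gamma>D_def algebra_simps)
  also have "w p * \<dots> = w p * dx \<gamma> p $ 2 - wx p * \<gamma> p $ 2"
    by (simp add: wx_eq[OF p] algebra_simps)
  also have "\<dots> = det (cols (\<gamma> p) (dx \<gamma> p))"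
    by (simp add: w_def wx_def inner_vec_def sum_2 det_2 cols_def algebra_simps)
  also have "\<dots> = 1" using caf unfolding caf_solution_on_def by blast
  finally show ?thesis .
qed

lemma caf_\<gamma>D: "caf_solution_on \<Omega> \<gamma>D qD"
  unfolding caf_solution_on_def central_affine_curvature_on_def
proof (intro conjI ballI smooth_\<gamma>D smooth_qD det_\<gamma>D dx_dx_\<gamma>D)
  fix p assume p: "p \<in> \<Omega>"
  show "\<gamma>D p \<noteq> 0" using det_\<gamma>D[OF p] by (auto simp: det_2 cols_def)
  show "dt \<gamma>D p = (1/4 * dx qD p) *\<^sub>R \<gamma>D p - (1/2 * qD p) *\<^sub>R dx \<gamma>D p"
    unfolding has_dt_imp_dt[OF \<gamma>D_derivs(2)[OF p]] dx_qD[OF p] dx_\<gamma>D[OF p] qD1_def qD_def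
    by (simp add: vec_eq_iff algebra_simps power2_eq_square)
qed

lemma M_apply:
  "M p *v cvec (vector [- \<xi>D p, 1]) =
    e12 *v cvec (- \<xi>D p *\<^sub>R \<gamma> p + dx \<gamma> p) + R *v (E1 p *v cvec (vector [- \<xi>D p, 1]))"
proof -
  have "frame \<gamma> p *v cvec (vector [- \<xi>D p, 1]) = cvec (- \<xi>D p *\<^sub>R \<gamma> p + dx \<gamma> p)"
    by (simp add: frame_def cvec_def matrix_vector_mult_def sum_2 vec_eq_iff)
  then show ?thesis
    by (simp add: M_def matrix_vector_mult_add_rdistrib matrix_vector_mul_assoc[symmetric])
qed

lemma cvec_\<gamma>D: "cvec (\<gamma>D p) = M p *v cvec (vector [- \<xi>D p, 1])"
  by (simp add: M_real cvec_def \<gamma>D_def matrix_vector_mult_def sum_2 vec_eq_iff)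

text \<open>The value at \<open>z = 0\<close> fills the removable singularity; that it is the right one is shown in
  \<open>ED_holomorphic\<close>.\<close>

definition ED where
  "ED p z = (if z = 0 then frame \<gamma>D p
    else smult_mat (inverse z) (r0 \<xi> z ** E p z ** r0 (- \<xi>D p) z))"

text \<open>The gauge property: \<open>\<rho> = r0 (-\<xi>D) z\<close> satisfies \<open>\<rho>' = \<rho> A\<^sub>D - A \<rho>\<close>, where \<open>A\<close> and \<open>A\<^sub>D\<close> are
  the Lax matrices of \<open>q\<close> and \<open>qD\<close>.\<close>

lemma r0_derivs:
  assumes p: "p \<in> \<Omega>"
  shows "has_dx (\<lambda>p. r0 (- \<xi>D p) z) (r0 (- \<xi>D p) z ** lax_U qD p z - lax_U q p z ** r0 (- \<xi>D p) z) p"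
    and "has_dt (\<lambda>p. r0 (- \<xi>D p) z) (r0 (- \<xi>D p) z ** lax_V qD p z - lax_V q p z ** r0 (- \<xi>D p) z) p"
proof -
  note D = \<xi>D_derivs[OF p]
  have 2: "has_dx (\<lambda>p. - \<xi>D p * - \<xi>D p) (2 * \<xi>D p * (q p - \<xi>D p * \<xi>D p)) p"
    "has_dt (\<lambda>p. - \<xi>D p * - \<xi>D p) (2 * \<xi>D p * (1/4 * dx (dx q) p - 1/2 * q p * q p - 1/2 * dx q p * \<xi>D p + 1/2 * q p * \<xi>D p * \<xi>D p)) p"
    by (rule has_dx_eq_rhs has_dt_eq_rhs, (rule has_dx_intros has_dt_intros D)+, simp add: algebra_simps)+
  have eq: "r0 (- \<xi>D p) z = mat22 (of_real (- \<xi>D p)) (of_real (- \<xi>D p * - \<xi>D p) + z) 1 (of_real (- \<xi>D p))" for p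
    by (simp add: r0_def power2_eq_square)
  note of_real_x = has_dx_linear[OF bounded_linear_of_real] and of_real_t = has_dt_linear[OF bounded_linear_of_real]
  show "has_dx (\<lambda>p. r0 (- \<xi>D p) z) (r0 (- \<xi>D p) z ** lax_U qD p z - lax_U q p z ** r0 (- \<xi>D p) z) p"
    unfolding eq
    by (rule has_dx_eq_rhs[OF has_derivs_mat22(1)[OF of_real_x[OF has_dx_minus[OF D(1)]]
            has_dx_add[OF of_real_x[OF 2(1)] has_dx_const] has_dx_const of_real_x[OF has_dx_minus[OF D(1)]]]])
      (simp add: lax_U_def mat22_mult vec_eq_iff forall_2 qD_def power2_eq_square algebra_simps)
  show "has_dt (\<lambda>p. r0 (- \<xi>D p) z) (r0 (- \<xi>D p) z ** lax_V qD p z - lax_V q p z ** r0 (- \<xi>D p) z) p"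
    unfolding eq
    by (rule has_dt_eq_rhs[OF has_derivs_mat22(2)[OF of_real_t[OF has_dt_minus[OF D(2)]]
            has_dt_add[OF of_real_t[OF 2(2)] has_dt_const] has_dt_const of_real_t[OF has_dt_minus[OF D(2)]]]])
      (simp add: lax_V_def mat22_mult vec_eq_iff forall_2 dx_qD[OF p] qD1_def qD2_def qD_def power2_eq_square field_simps)
qed

text \<open>A constant left factor does not affect the equations, and the terms \<open>E A \<rho>\<close> cancel.\<close>

lemma dressed_derivs:
  fixes A :: "complex^2^2"
  assumes p: "p \<in> \<Omega>"
  shows "has_dx (\<lambda>p. A ** E p z ** r0 (- \<xi>D p) z) (A ** E p z ** r0 (- \<xi>D p) z ** lax_U qD p z) p"
    and "has_dt (\<lambda>p. A ** E p z ** r0 (- \<xi>D p) z) (A ** E p z ** r0 (- \<xi>D p) z ** lax_V qD p z) p"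
proof -
  interpret m: bounded_bilinear "(**) :: complex^2^2 \<Rightarrow> complex^2^2 \<Rightarrow> complex^2^2"
    by (rule bounded_bilinear_matrix_mult)
  show "has_dx (\<lambda>p. A ** E p z ** r0 (- \<xi>D p) z) (A ** E p z ** r0 (- \<xi>D p) z ** lax_U qD p z) p"
    by (rule has_dx_eq_rhs[OF has_dx_matrix_mult[OF has_dx_linear[OF m.bounded_linear_right E_derivs(1)] r0_derivs(1)[OF p]]])
      (simp add: m.diff_right matrix_mul_assoc)
  show "has_dt (\<lambda>p. A ** E p z ** r0 (- \<xi>D p) z) (A ** E p z ** r0 (- \<xi>D p) z ** lax_V qD p z) p"
    by (rule has_dt_eq_rhs[OF has_dt_matrix_mult[OF has_dt_linear[OF m.bounded_linear_right E_derivs(2)] r0_derivs(2)[OF p]]])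
      (simp add: m.diff_right matrix_mul_assoc)
qed

lemma ED_derivs:
  assumes p: "p \<in> \<Omega>"
  shows "has_dx (\<lambda>p. ED p z) (ED p z ** lax_U qD p z) p"
    and "has_dt (\<lambda>p. ED p z) (ED p z ** lax_V qD p z) p"
proof -
  have "has_dx (\<lambda>p. ED p z) (ED p z ** lax_U qD p z) p \<and> has_dt (\<lambda>p. ED p z) (ED p z ** lax_V qD p z) p"
  proof (cases "z = 0")
    case True
    then show ?thesis using frame_has_derivatives[OF open_\<Omega> caf_\<gamma>D p] by (simp add: ED_def[abs_def])
  next
    case False
    then show ?thesis
      using dressed_derivs[OF p, of "mat (inverse z) ** r0 \<xi> z" z]
      by (simp add: ED_def[abs_def] smult_mat_eq_mat_mult matrix_mul_assoc)
  qed
  then show "has_dx (\<lambda>p. ED p z) (ED p z ** lax_U qD p z) p"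
    "has_dt (\<lambda>p. ED p z) (ED p z ** lax_V qD p z) p" by auto
qed

text \<open>For \<open>z \<noteq> 0\<close> both factors \<open>r0\<close> have determinant \<open>-z\<close>, which the scalar \<open>z\<^sup>-\<^sup>1\<close> compensates.\<close>

lemma det_ED:
  assumes p: "p \<in> \<Omega>"
  shows "det (ED p z) = 1"
proof (cases "z = 0")
  case True
  then show ?thesis using det_frame[OF det_\<gamma>D[OF p]] by (simp add: ED_def)
next
  case False
  have "det (E p z) = 1" using lax unfolding extended_frame_on_def by blast
  with False show ?thesis
    by (simp add: ED_def smult_mat_eq_mat_mult det_mul)
      (simp add: mat_2_eq_mat22 r0_def det_mat22 power2_eq_square field_simps)
qed

lemma cnj_r0: "cnj (r0 c (cnj z) $ i $ j) = r0 c z $ i $ j"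
proof -
  have "\<forall>i j. cnj (r0 c (cnj z) $ i $ j) = r0 c z $ i $ j"
    unfolding forall_2 r0_def mat22_nth by simp
  then show ?thesis by blast
qed

lemma cnj_ED: "cnj_mat (ED p (cnj z)) = ED p z"
proof (cases "z = 0")
  case True
  then show ?thesis by (simp add: ED_def frame_def cnj_mat_def map_matrix_def vec_eq_iff forall_2)
next
  case False
  have "cnj_mat (E p (cnj z)) = E p z" using lax unfolding extended_frame_on_def by blast
  then have "cnj (E p (cnj z) $ i $ j) = E p z $ i $ j" for i j
    by (simp add: cnj_mat_def map_matrix_def vec_eq_iff)
  with False show ?thesis
    by (simp add: ED_def smult_mat_def cnj_mat_def map_matrix_def vec_eq_iff matrix_matrix_mult_def cnj_r0)
qed

text \<open>The product without the factor \<open>z\<^sup>-\<^sup>1\<close> vanishes at 0, because \<open>(w, wx)\<close> is annihilated by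
  \<open>r0 (-\<xi>D) 0\<close>; its derivative there is the frame of \<open>\<gamma>D\<close>.\<close>

lemma ED_holomorphic:
  assumes p: "p \<in> \<Omega>"
  shows "(\<lambda>z. ED p z $ i $ j) holomorphic_on UNIV"
proof (rule pole_theorem_0[where a=0 and g="\<lambda>z. (r0 \<xi> z ** E p z ** r0 (- \<xi>D p) z) $ i $ j"])
  interpret m: bounded_bilinear "(**) :: complex^2^2 \<Rightarrow> complex^2^2 \<Rightarrow> complex^2^2"
    by (rule bounded_bilinear_matrix_mult)
  have r0: "(\<lambda>z. r0 c z $ i $ j) holomorphic_on UNIV" for c i j
    unfolding holomorphic_on_open[OF open_UNIV] using r0_entry_derivative by blast
  show "(\<lambda>z. (r0 \<xi> z ** E p z ** r0 (- \<xi>D p) z) $ i $ j) holomorphic_on UNIV"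
    by (simp add: matrix_matrix_mult_def) (intro holomorphic_intros r0 holomorphic_entry)
  show "(r0 \<xi> z ** E p z ** r0 (- \<xi>D p) z) $ i $ j = (z - 0) * ED p z $ i $ j" if "z \<in> UNIV - {0}" for z
    using that by (simp add: ED_def smult_mat_def map_matrix_def)
  have R: "r0 \<xi> 0 = R" by (simp add: r0_def R_eq)
  have zero: "R ** frame \<gamma> p ** r0 (- \<xi>D p) 0 = 0"
    unfolding R_frame
    by (simp add: vec_eq_iff forall_2 matrix_matrix_mult_def sum_2 r0_def wx_eq[OF p] power2_eq_square)
  then show "(r0 \<xi> 0 ** E p 0 ** r0 (- \<xi>D p) 0) $ i $ j = 0"
    by (simp add: R frame_at_zero)
  have "((\<lambda>z. (r0 \<xi> z ** E p z ** r0 (- \<xi>D p) z) $ i $ j) has_field_derivative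
      (r0 \<xi> 0 ** E p 0 ** e12 + (r0 \<xi> 0 ** E1 p + e12 ** E p 0) ** r0 (- \<xi>D p) 0) $ i $ j) (at 0)"
    by (intro matrix_mult_entry_derivative r0_entry_derivative entry_has_derivative)
  then have "deriv (\<lambda>z. (r0 \<xi> z ** E p z ** r0 (- \<xi>D p) z) $ i $ j) 0 =
      (R ** frame \<gamma> p ** e12 + M p ** r0 (- \<xi>D p) 0) $ i $ j"
    using DERIV_imp_deriv by (simp add: R frame_at_zero M_def add.commute)
  also have "R ** frame \<gamma> p ** e12 + M p ** r0 (- \<xi>D p) 0 = ED p 0"
    unfolding R_frame M_real
    by (simp add: ED_def frame_def dx_\<gamma>D[OF p])
      (simp add: \<gamma>D_def vec_eq_iff forall_2 matrix_matrix_mult_def sum_2 r0_def e12_def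
        power2_eq_square algebra_simps)
  finally show "ED p 0 $ i $ j = deriv (\<lambda>z. (r0 \<xi> z ** E p z ** r0 (- \<xi>D p) z) $ i $ j) 0" by simp
qed simp

lemma extended_frame_ED: "extended_frame_on \<Omega> qD ED"
  unfolding extended_frame_on_def
  using kdv_qD det_ED ED_holomorphic cnj_ED ED_derivs
  by (fastforce simp: has_dx_def has_dt_def)

end

theorem theorem3p8:
  fixes \<gamma> :: "real \<times> real \<Rightarrow> real^2"
    and q :: "real \<times> real \<Rightarrow> real"
    and E :: "real \<times> real \<Rightarrow> complex \<Rightarrow> complex^2^2"
    and \<xi> :: real
    and \<O> :: "(real \<times> real) set"
  assumes "caf_solution_on UNIV \<gamma> q"
    and "extended_frame_on UNIV q E"
    and "E (0, 0) 0 = cmat (cols (\<gamma> (0, 0)) (dx \<gamma> (0, 0)))"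
    and "open \<O>"
    and "\<forall>p\<in>\<O>. vector [1, \<xi>] \<bullet> \<gamma> p \<noteq> 0"
  shows "(\<forall>p z. (\<lambda>n. smult_mat (z ^ n) (lambda_coeff E n p)) sums E p z) \<and>
    (\<forall>p. lambda_coeff E 0 p = E p 0 \<and> E p 0 = cmat (cols (\<gamma> p) (dx \<gamma> p))) \<and>
    (\<exists>\<gamma>t :: real \<times> real \<Rightarrow> real^2.
       (\<forall>p\<in>\<O>. cvec (\<gamma>t p) =
          e12 *v cvec (- xi_tilde \<xi> \<gamma> p *\<^sub>R \<gamma> p + dx \<gamma> p) +
          cmat (mat22 \<xi> (\<xi>^2) 1 \<xi>) *v
            (lambda_coeff E 1 p *v cvec (vector [- xi_tilde \<xi> \<gamma> p, 1]))) \<and>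
       caf_solution_on \<O> \<gamma>t (\<lambda>p. - q p + 2 * (xi_tilde \<xi> \<gamma> p)^2)) \<and>
    (\<exists>Et :: real \<times> real \<Rightarrow> complex \<Rightarrow> complex^2^2.
       (\<forall>p\<in>\<O>. \<forall>z. z \<noteq> 0 \<longrightarrow>
          Et p z = smult_mat (inverse z) (r0 \<xi> z ** E p z ** r0 (- xi_tilde \<xi> \<gamma> p) z)) \<and>
       extended_frame_on \<O> (\<lambda>p. - q p + 2 * (xi_tilde \<xi> \<gamma> p)^2) Et)"
proof -
  interpret darboux \<gamma> q E \<xi> \<O>
    by unfold_locales (use assms in \<open>auto simp: frame_def\<close>)
  have qD: "(\<lambda>p. - q p + 2 * (xi_tilde \<xi> \<gamma> p)^2) = qD"
    by (rule ext) (simp add: qD_def)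
  show ?thesis
    unfolding qD
  proof (intro conjI allI)
    show "(\<lambda>n. smult_mat (z ^ n) (lambda_coeff E n p)) sums E p z" for p z
      by (rule power_series)
    show "lambda_coeff E 0 p = E p 0" for p
      by (rule lambda_coeff_0)
    show "E p 0 = cmat (cols (\<gamma> p) (dx \<gamma> p))" for p
      by (simp add: frame_at_zero frame_def)
    show "\<exists>\<gamma>t. (\<forall>p\<in>\<O>. cvec (\<gamma>t p) =
          e12 *v cvec (- xi_tilde \<xi> \<gamma> p *\<^sub>R \<gamma> p + dx \<gamma> p) +
          cmat (mat22 \<xi> (\<xi>^2) 1 \<xi>) *v
            (lambda_coeff E 1 p *v cvec (vector [- xi_tilde \<xi> \<gamma> p, 1]))) \<and>
        caf_solution_on \<O> \<gamma>t qD"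
      using cvec_\<gamma>D M_apply caf_\<gamma>D unfolding R_def by metis
    show "\<exists>Et. (\<forall>p\<in>\<O>. \<forall>z. z \<noteq> 0 \<longrightarrow>
          Et p z = smult_mat (inverse z) (r0 \<xi> z ** E p z ** r0 (- xi_tilde \<xi> \<gamma> p) z)) \<and>
        extended_frame_on \<O> qD Et"
      using extended_frame_ED by (auto simp: ED_def intro!: exI[of _ ED])
  qed
qed

end
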